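(* Let $A=\{A_i\}_{1\le i\le n+1}$ ($n\ge3$) be a polygon in $\mathbb{R}^N$ which realizes equality in the Reilly inequality for polygons, i.e. $$\mathcal{H}^1(K_A)\,\lambda_1^A=\sum_{i=1}^n|\mathbf{H}_i|^2,\qquad \mathbf{H}_i=\frac{A_i-A_{i-1}}{|A_i-A_{i-1}|}+\frac{A_i-A_{i+1}}{|A_i-A_{i+1}|}.$$ Then $A$ is a planar regular polygon, or a losange (planar rhombus), or (up to similarity) a trapeze $T_\theta$ for some $\theta\in(0,\pi/2)$, or (up to similarity) a fake-regular polygon $F_p$ for some integer $p\ge2$.
   Context: For $n\ge3$, a polygon $A=\{A_i\}_{1\le i\le n+1}$ with vertices $A_i\in\mathbb{R}^N$ means: $A_{n+1}=A_1$ (and $A_0:=A_n$), the open segment $]A_i,A_{i+1}[$ does not intersect any other segment $]A_j,A_{j+1}[$, and each vertex $A_i$ belongs to the two consecutive segments $[A_{i-1},A_i]$ and $[A_i,A_{i+1}]$ and to no other one. $K_A=\bigcup_{i=1}^n[A_i,A_{i+1}]$, and $$\lambda_1^A:=\inf\left\{\frac{\int_{K_A}|\nabla_P u|^2\,d\mathcal{H}^1}{\sum_{i=1}^n u(A_i)^2}\;:\;u\in C^\infty(\mathbb{R}^N),\ \sum_{i=1}^n u(A_i)^2\ne0,\ \sum_{i=1}^n u(A_i)=0\right\},$$ where $\nabla_P u$ is the orthogonal projection of $\nabla u$ onto the line spanned by $A_{i+1}-A_i$ on the segment $[A_i,A_{i+1}]$. Trapeze: for $\theta\in(0,\pi/2)$,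 $T_\theta$ is the planar polygon with consecutive vertices $(\cos\theta,\sin\theta)$, $(-\cos\theta,\sin\theta)$, $(-\tan\theta\sin\theta,-\sin\theta)$, $(\tan\theta\sin\theta,-\sin\theta)$. Fake-regular polygon: for an integer $p\ge2$, $F_p$ is the planar polygon with $p+2$ consecutive vertices $B_0,B_1,\dots,B_{p+1}$ (closed up by joining $B_{p+1}$ to $B_0$) built as follows: fix a point $O$ and $B_1$ with $|B_1-O|=1$; for $2\le k\le p+1$, $B_k$ is the image of $B_1$ by the rotation of center $O$ and angle $(k-1)\pi/p$; $B_0$ is the point of the perpendicular bisector of $[B_1,B_{p+1}]$ such that the angles of the polygon at $B_1$ and $B_{p+1}$ both equal $\theta_p=(1-1/p)\pi$, which is also the angle at $B_2,\dots,B_p$ (thus $B_0$ lies on the side of the line $B_1B_{p+1}$ opposite to the half circle carrying $B_1,\dots,B_{p+1}$, at distance $\cot(\pi/(2p))$ from $O$). *)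

theory Defs
  imports "HOL-Analysis.Analysis"
begin

subsection \<open>Polygons\<close>

text \<open>Vertices are indexed as \<open>A 1, \<dots>, A n\<close>, with the conventions \<open>A 0 = A n\<close> and
  \<open>A (n + 1) = A 1\<close>; the \<open>i\<close>-th side is \<open>[A i, A (i + 1)]\<close> for \<open>1 \<le> i \<le> n\<close>.  The side
  \<open>[A (i - 1), A i]\<close> has index \<open>i - 1\<close> if \<open>i > 1\<close> and index \<open>n\<close> if \<open>i = 1\<close>.  A polygon may have
  flat angles; its vertices are automatically pairwise distinct.\<close>

definition polygon :: "nat \<Rightarrow> (nat \<Rightarrow> 'a::euclidean_space) \<Rightarrow> bool" where
  "polygon n A \<longleftrightarrow>
     3 \<le> n \<and> A (n + 1) = A 1 \<and> A 0 = A n \<and>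
     (\<forall>i\<in>{1..n}. \<forall>j\<in>{1..n}. j \<noteq> i \<longrightarrow>
        open_segment (A i) (A (i + 1)) \<inter> closed_segment (A j) (A (j + 1)) = {}) \<and>
     (\<forall>i\<in>{1..n}. \<forall>j\<in>{1..n}. A i \<in> closed_segment (A j) (A (j + 1)) \<longrightarrow>
        j = i \<or> j + 1 = i \<or> (i = 1 \<and> j = n))"

definition polygon_curve :: "nat \<Rightarrow> (nat \<Rightarrow> 'a::euclidean_space) \<Rightarrow> 'a set" where
  "polygon_curve n A = (\<Union>i\<in>{1..n}. closed_segment (A i) (A (i + 1)))"

definition vertex_curvature :: "(nat \<Rightarrow> 'a::euclidean_space) \<Rightarrow> nat \<Rightarrow> 'a" where
  "vertex_curvature A i =
     (A i - A (i - 1)) /\<^sub>R norm (A i - A (i - 1)) + (A i - A (i + 1)) /\<^sub>R norm (A i - A (i + 1))"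

subsection \<open>One-dimensional Hausdorff measure\<close>

text \<open>\<open>hausdorff1_pre \<delta> S\<close> is the infimum of the sums of diameters over the countable covers of
  \<open>S\<close> by sets of diameter at most \<open>\<delta>\<close>.  Boundedness is required explicitly because
  \<^const>\<open>diameter\<close> is real-valued.\<close>

definition hausdorff1_pre :: "real \<Rightarrow> 'a::euclidean_space set \<Rightarrow> ennreal" where
  "hausdorff1_pre \<delta> S =
     (INF C \<in> {C :: nat \<Rightarrow> 'a set. S \<subseteq> (\<Union>k. C k) \<and> (\<forall>k. bounded (C k) \<and> diameter (C k) \<le> \<delta>)}.
        \<Sum>k. ennreal (diameter (C k)))"

definition hausdorff1_outer :: "'a::euclidean_space set \<Rightarrow> ennreal" where
  "hausdorff1_outer S = (SUP \<delta>\<in>{0<..}. hausdorff1_pre \<delta> S)"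

definition hausdorff1 :: "'a::euclidean_space measure" where
  "hausdorff1 = measure_of UNIV (sets borel) hausdorff1_outer"

subsection \<open>The first eigenvalue of a polygon\<close>

primrec Ck :: "nat \<Rightarrow> ('a::euclidean_space \<Rightarrow> real) \<Rightarrow> bool" where
  "Ck 0 u \<longleftrightarrow> continuous_on UNIV u"
| "Ck (Suc k) u \<longleftrightarrow>
     u differentiable_on UNIV \<and> (\<forall>v. Ck k (\<lambda>x. frechet_derivative u (at x) v))"

definition smooth :: "('a::euclidean_space \<Rightarrow> real) \<Rightarrow> bool" where
  "smooth u \<longleftrightarrow> (\<forall>k. Ck k u)"

definition gradient :: "('a::euclidean_space \<Rightarrow> real) \<Rightarrow> 'a \<Rightarrow> 'a" where
  "gradient u x = (THE D. GDERIV u x :> D)"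

definition line_projection :: "'a::euclidean_space \<Rightarrow> 'a \<Rightarrow> 'a" where
  "line_projection v w = ((w \<bullet> v) / (v \<bullet> v)) *\<^sub>R v"

text \<open>A point of the curve other than a vertex lies on exactly one side.  At a vertex, which lies on
  two sides, the value is immaterial for the integral; there the side of smaller index is used.\<close>

definition side_index :: "nat \<Rightarrow> (nat \<Rightarrow> 'a::euclidean_space) \<Rightarrow> 'a \<Rightarrow> nat" where
  "side_index n A x = (LEAST i. i \<in> {1..n} \<and> x \<in> closed_segment (A i) (A (i + 1)))"

definition tangential_gradient ::
    "nat \<Rightarrow> (nat \<Rightarrow> 'a::euclidean_space) \<Rightarrow> ('a \<Rightarrow> real) \<Rightarrow> 'a \<Rightarrow> 'a" where
  "tangential_gradient n A u x =
     (let i = side_index n A x in line_projection (A (i + 1) - A i) (gradient u x))"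

definition first_eigenvalue :: "nat \<Rightarrow> (nat \<Rightarrow> 'a::euclidean_space) \<Rightarrow> real" where
  "first_eigenvalue n A =
     Inf {(LINT x:polygon_curve n A|hausdorff1. (norm (tangential_gradient n A u x))\<^sup>2)
            / (\<Sum>i=1..n. (u (A i))\<^sup>2) | u.
          smooth u \<and> (\<Sum>i=1..n. (u (A i))\<^sup>2) \<noteq> 0 \<and> (\<Sum>i=1..n. u (A i)) = 0}"

subsection \<open>The model polygons\<close>

text \<open>Model polygons live in the Euclidean plane \<^typ>\<open>complex\<close> and have consecutive vertices
  \<open>B 0, \<dots>, B (n - 1)\<close>.  \<open>A\<close> is similar to such a polygon if it is its image under a similarity from
  the plane into the ambient space; the starting vertex and the direction in which the vertices
  are enumerated are irrelevant.\<close>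

definition similar_to_planar ::
    "nat \<Rightarrow> (nat \<Rightarrow> 'a::euclidean_space) \<Rightarrow> (nat \<Rightarrow> complex) \<Rightarrow> bool" where
  "similar_to_planar n A B \<longleftrightarrow>
     (\<exists>(f :: complex \<Rightarrow> 'a) r s. 0 < r \<and> (\<forall>z w. dist (f z) (f w) = r * dist z w) \<and>
        ((\<forall>i\<in>{1..n}. A i = f (B ((s + i) mod n))) \<or>
         (\<forall>i\<in>{1..n}. A i = f (B ((s + (n - i)) mod n)))))"

definition regular_polygon :: "nat \<Rightarrow> (nat \<Rightarrow> 'a::euclidean_space) \<Rightarrow> bool" where
  "regular_polygon n A \<longleftrightarrow> similar_to_planar n A (\<lambda>k. cis (2 * pi * real k / real n))"

definition rhombus :: "nat \<Rightarrow> (nat \<Rightarrow> 'a::euclidean_space) \<Rightarrow> bool" where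
  "rhombus n A \<longleftrightarrow> n = 4 \<and> coplanar (A ` {1..4}) \<and>
     (\<forall>i\<in>{1..4}. dist (A i) (A (i + 1)) = dist (A 1) (A 2))"

definition trapeze :: "real \<Rightarrow> nat \<Rightarrow> complex" where
  "trapeze \<theta> k =
     [Complex (cos \<theta>) (sin \<theta>), Complex (- cos \<theta>) (sin \<theta>),
      Complex (- tan \<theta> * sin \<theta>) (- sin \<theta>), Complex (tan \<theta> * sin \<theta>) (- sin \<theta>)] ! k"

definition vertex_angle :: "'a::euclidean_space \<Rightarrow> 'a \<Rightarrow> 'a \<Rightarrow> real" where
  "vertex_angle x y z = arccos (((x - y) \<bullet> (z - y)) / (norm (x - y) * norm (z - y)))"

text \<open>The conditions determine \<open>B 0, \<dots>, B (p + 1)\<close> up to an orientation-preserving isometry of the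
  plane: for \<open>c = 0\<close> and \<open>B 1 = 1\<close> the point of the bisector with the prescribed angles can only be
  \<open>B 0 = - \<i> * cot (pi / (2 * p))\<close>.\<close>

definition fake_regular_polygon :: "nat \<Rightarrow> (nat \<Rightarrow> complex) \<Rightarrow> bool" where
  "fake_regular_polygon p B \<longleftrightarrow> 2 \<le> p \<and>
     (\<exists>c. dist (B 1) c = 1 \<and>
        (\<forall>k\<in>{2..p+1}. B k = c + cis (real (k - 1) * pi / real p) * (B 1 - c))) \<and>
     dist (B 0) (B 1) = dist (B 0) (B (p + 1)) \<and>
     vertex_angle (B 0) (B 1) (B 2) = (1 - 1 / real p) * pi \<and>
     vertex_angle (B p) (B (p + 1)) (B 0) = (1 - 1 / real p) * pi"

end

theory Submission
  imports Defs
begin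

text \<open>Testing \<open>\<lambda>\<^sub>1\<close> with the coordinate functions shows that equality forces
  \<open>H\<^sub>i = c (A\<^sub>i - g)\<close> for a constant \<open>c > 0\<close> and the barycentre \<open>g\<close>.  For the unit side vectors
  \<open>e\<^sub>i\<close> this reads \<open>e\<^sub>i\<^sub>-\<^sub>1 - e\<^sub>i = c (A\<^sub>i - g)\<close>, so \<open>e\<^sub>i\<^sub>+\<^sub>1 + e\<^sub>i\<^sub>-\<^sub>1\<close> is a multiple of \<open>e\<^sub>i\<close>: the polygon
  is planar, its turning angles take only two supplementary values \<open>\<alpha>\<close> and \<open>\<pi> - \<alpha>\<close>, and all
  its sides are tangent to one circle centred at \<open>g\<close>.  Since the sides do not cross, the total
  turning is \<open>2 \<pi>\<close>, which leaves room for at most two angles \<open>\<pi> - \<alpha> > \<pi> / 2\<close> unless the polygon is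
  a regular triangle: no such angle gives a regular polygon, one a fake-regular polygon, two a
  rhombus or a trapeze.\<close>

subsection \<open>Upper bounds for Hausdorff measure and energy\<close>

lemma diameter_closed_segment_le: "diameter (closed_segment a b) \<le> dist a (b::'a::euclidean_space)"
proof (rule diameter_le)
  fix x y assume "x \<in> closed_segment a b" "y \<in> closed_segment a b"
  then show "norm (x - y) \<le> dist a b"
    using segment_bound1 dist_in_closed_segment dist_decreases_closed_segment
    by (smt (verit, best) Line_Segment.closed_segment_subset closed_segment_commute
        convex_closed_segment dist_commute dist_norm ends_in_segment)
qed simp

text \<open>Cut the segment into \<open>m\<close> equal pieces of length at most
  \<open>\<delta>\<close>; their diameters add up to at most the full length.\<close>

lemma hausdorff1_pre_segment_le:
  fixes a b :: "'a::euclidean_space"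
  assumes "0 < \<delta>"
  shows "hausdorff1_pre \<delta> (closed_segment a b) \<le> ennreal (dist a b)"
proof -
  obtain m :: nat where m: "dist a b / \<delta> < real m" using reals_Archimedean2 by blast
  have "0 \<le> dist a b / \<delta>" using assms by simp
  with m have m0: "0 < m" by (metis less_le_trans not_less of_nat_0 of_nat_0_less_iff order_less_irrefl)
  define p where "p k = a + (real k / real m) *\<^sub>R (b - a)" for k
  define C where "C k = (if k < m then closed_segment (p k) (p (Suc k)) else {})" for k
  have dist_p: "dist (p k) (p (Suc k)) = dist a b / real m" for k
  proof -
    have "p (Suc k) - p k = (1 / real m) *\<^sub>R (b - a)"
      by (simp add: p_def algebra_simps add_divide_distrib)
    then have "dist (p (Suc k)) (p k) = dist b a / real m"
      by (simp add: dist_norm)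
    then show ?thesis by (simp add: dist_commute)
  qed
  have diam: "diameter (C k) \<le> dist a b / real m" for k
    using diameter_closed_segment_le[of "p k" "p (Suc k)"] by (simp add: C_def dist_p)
  have "dist a b / real m \<le> \<delta>"
    using m m0 assms by (simp add: field_simps)
  with diam have small: "\<forall>k. bounded (C k) \<and> diameter (C k) \<le> \<delta>"
    by (metis C_def bounded_closed_segment bounded_empty order_trans)
  have cover: "closed_segment a b \<subseteq> (\<Union>k. C k)"
  proof
    fix x assume "x \<in> closed_segment a b"
    then obtain t where t: "0 \<le> t" "t \<le> 1" "x = (1 - t) *\<^sub>R a + t *\<^sub>R b"
      by (auto simp: in_segment)
    \<comment> \<open>The piece containing the parameter \<open>t\<close>; at \<open>t = 1\<close>
      the floor would give \<open>m\<close>, one past the last piece.\<close>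
    define k where "k = (if t = 1 then m - 1 else nat \<lfloor>t * real m\<rfloor>)"
    have k: "k < m" "real k \<le> t * real m" "t * real m \<le> real k + 1"
    proof -
      have "t < 1 \<Longrightarrow> t * real m < real m" using m0 by simp
      then show "k < m" using m0 t unfolding k_def by (auto simp: nat_less_iff floor_less_iff)
      show "real k \<le> t * real m" "t * real m \<le> real k + 1"
        using m0 t unfolding k_def by (auto simp: of_nat_diff)
    qed
    define u where "u = t * real m - real k"
    have "x = (1 - u) *\<^sub>R p k + u *\<^sub>R p (Suc k)"
    proof -
      have "(1 - u) *\<^sub>R p k + u *\<^sub>R p (Suc k) = a + ((real k + u) / real m) *\<^sub>R (b - a)"
        by (simp add: p_def algebra_simps add_divide_distrib diff_divide_distrib)
      also have "(real k + u) / real m = t" using m0 by (simp add: u_def)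
      also have "a + t *\<^sub>R (b - a) = x" using t by (simp add: algebra_simps)
      finally show ?thesis ..
    qed
    then have "x \<in> C k" using k by (auto simp: C_def in_segment u_def intro!: exI[of _ u])
    then show "x \<in> (\<Union>k. C k)" by blast
  qed
  have "(\<Sum>k. ennreal (diameter (C k))) = (\<Sum>k<m. ennreal (diameter (C k)))"
    by (rule suminf_finite) (auto simp: C_def)
  also have "\<dots> \<le> (\<Sum>k<m. ennreal (dist a b / real m))"
    by (intro sum_mono ennreal_leI diam)
  also have "\<dots> = ennreal (dist a b)"
    using m0 by (subst sum_ennreal) auto
  finally show ?thesis
    unfolding hausdorff1_pre_def using small cover by (intro INF_lower2[of C]) auto
qed

lemma sets_hausdorff1 [simp]: "sets hausdorff1 = sets borel"
  unfolding hausdorff1_def by (simp add: sets_measure_of_conv sets.sigma_sets_eq[of borel, simplified])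

text \<open>\<^const>\<open>measure_of\<close> yields the null measure if the given set function is not a measure, so
  this inequality, which is all that is needed, does not depend on Caratheodory's theorem.\<close>

lemma emeasure_hausdorff1_le: "emeasure hausdorff1 S \<le> hausdorff1_outer S"
  unfolding hausdorff1_def by (simp add: emeasure_measure_of_conv)

lemma emeasure_hausdorff1_segment_le: "emeasure hausdorff1 (closed_segment a b) \<le> ennreal (dist a b)"
  by (rule order_trans[OF emeasure_hausdorff1_le])
    (auto simp: hausdorff1_outer_def intro!: SUP_least hausdorff1_pre_segment_le)

lemma measure_polygon_curve_le:
  "measure hausdorff1 (polygon_curve n A) \<le> (\<Sum>i=1..n. dist (A i) (A (i + 1)))"
proof -
  have "emeasure hausdorff1 (polygon_curve n A)
      \<le> (\<Sum>i=1..n. emeasure hausdorff1 (closed_segment (A i) (A (i + 1))))"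
    unfolding polygon_curve_def by (rule emeasure_subadditive_finite) auto
  also have "\<dots> \<le> (\<Sum>i=1..n. ennreal (dist (A i) (A (i + 1))))"
    by (intro sum_mono emeasure_hausdorff1_segment_le)
  also have "\<dots> = ennreal (\<Sum>i=1..n. dist (A i) (A (i + 1)))"
    by (rule sum_ennreal) auto
  finally show ?thesis
    unfolding measure_def by (meson enn2real_leI sum_nonneg zero_le_dist)
qed

section \<open>Linear test functions and their energy\<close>

lemma Ck_const: "Ck k (\<lambda>x. c)"
  by (induction k arbitrary: c) (auto simp: frechet_derivative_const)

text \<open>In a fixed direction the derivative is a constant function of the point, so
  \<open>Ck_const\<close> covers all higher orders.\<close>

lemma smooth_affine: "smooth (\<lambda>x. (x - g) \<bullet> v)"
  unfolding smooth_def
proof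
  fix k
  have D: "((\<lambda>x. (x - g) \<bullet> v) has_derivative (\<lambda>h. h \<bullet> v)) (at x)" for x
    by (auto intro!: derivative_eq_intros)
  then have fd: "frechet_derivative (\<lambda>x. (x - g) \<bullet> v) (at x) = (\<lambda>h. h \<bullet> v)" for x
    by (metis frechet_derivative_at)
  show "Ck k (\<lambda>x. (x - g) \<bullet> v)"
  proof (cases k)
    case 0 then show ?thesis by (auto intro!: continuous_intros)
  next
    case (Suc l)
    have "(\<lambda>x. (x - g) \<bullet> v) differentiable_on UNIV"
      using D by (auto simp: differentiable_on_def intro: differentiableI)
    then show ?thesis by (simp add: Suc fd Ck_const)
  qed
qed

lemma gradient_affine: "gradient (\<lambda>x. (x - g) \<bullet> v) x = v"
  unfolding gradient_def
proof (rule the_equality)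
  show g: "GDERIV (\<lambda>x. (x - g) \<bullet> v) x :> v"
    unfolding gderiv_def by (auto intro!: derivative_eq_intros)
  show "D = v" if "GDERIV (\<lambda>x. (x - g) \<bullet> v) x :> D" for D
    using has_derivative_unique[OF that[unfolded gderiv_def] g[unfolded gderiv_def]]
    by (metis inner_commute vector_eq_ldot)
qed

text \<open>The tangential gradient has constant norm along each side, so the integrand is dominated
  by a combination of indicators of sides, and the length bound for segments applies to
  each.\<close>

lemma affine_energy_le:
  "(LINT x:polygon_curve n A|hausdorff1. (norm (tangential_gradient n A (\<lambda>x. (x - g) \<bullet> v) x))\<^sup>2)
     \<le> (\<Sum>i=1..n. ((A (i + 1) - A i) \<bullet> v)\<^sup>2 / dist (A i) (A (i + 1)))"
proof -
  define s where "s i = closed_segment (A i) (A (i + 1))" for i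
  define c where "c i = (norm (line_projection (A (i + 1) - A i) v))\<^sup>2" for i
  have "indicator (polygon_curve n A) x *\<^sub>R (norm (tangential_gradient n A (\<lambda>x. (x - g) \<bullet> v) x))\<^sup>2
      \<le> (\<Sum>i=1..n. c i * indicator (s i) x)" for x
  proof (cases "x \<in> polygon_curve n A")
    case True
    define i where "i = side_index n A x"
    have "\<exists>i. i \<in> {1..n} \<and> x \<in> closed_segment (A i) (A (i + 1))"
      using True by (auto simp: polygon_curve_def)
    then have "i \<in> {1..n} \<and> x \<in> s i"
      unfolding i_def side_index_def s_def by (rule LeastI_ex)
    moreover have "c i * indicator (s i) x \<le> (\<Sum>i=1..n. c i * indicator (s i) x)"
      if "i \<in> {1..n}" using that by (intro member_le_sum) (auto simp: c_def)
    ultimately show ?thesis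
      using True by (simp add: tangential_gradient_def Let_def gradient_affine c_def i_def)
  next
    case False
    then show ?thesis by (simp add: c_def sum_nonneg)
  qed
  then have "(\<integral>\<^sup>+x. ennreal (indicator (polygon_curve n A) x *\<^sub>R
        (norm (tangential_gradient n A (\<lambda>x. (x - g) \<bullet> v) x))\<^sup>2) \<partial>hausdorff1)
      \<le> (\<integral>\<^sup>+x. (\<Sum>i=1..n. ennreal (c i) * indicator (s i) x) \<partial>hausdorff1)"
    by (intro nn_integral_mono)
      (simp add: c_def ennreal_indicator[symmetric] ennreal_mult'[symmetric] ennreal_leI del: ennreal_indicator)
  also have "\<dots> = (\<Sum>i=1..n. ennreal (c i) * emeasure hausdorff1 (s i))"
  proof -
    have s: "s i \<in> sets hausdorff1" for i by (simp add: s_def)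
    then have "(\<lambda>x. ennreal (c i) * indicator (s i) x) \<in> borel_measurable hausdorff1" for i
      by (intro borel_measurable_times_ennreal borel_measurable_const borel_measurable_indicator)
    then have "(\<integral>\<^sup>+x. (\<Sum>i=1..n. ennreal (c i) * indicator (s i) x) \<partial>hausdorff1)
        = (\<Sum>i=1..n. \<integral>\<^sup>+x. ennreal (c i) * indicator (s i) x \<partial>hausdorff1)"
      by (intro nn_integral_sum)
    then show ?thesis using s by (simp only: nn_integral_cmult_indicator)
  qed
  also have "\<dots> \<le> (\<Sum>i=1..n. ennreal (c i) * ennreal (dist (A i) (A (i + 1))))"
    unfolding s_def by (intro sum_mono mult_left_mono emeasure_hausdorff1_segment_le) auto
  also have "\<dots> = ennreal (\<Sum>i=1..n. c i * dist (A i) (A (i + 1)))"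
    by (simp add: c_def ennreal_mult'[symmetric] sum_ennreal)
  also have "(\<Sum>i=1..n. c i * dist (A i) (A (i + 1)))
      = (\<Sum>i=1..n. ((A (i + 1) - A i) \<bullet> v)\<^sup>2 / dist (A i) (A (i + 1)))"
  proof (rule sum.cong)
    fix i
    have "c i = ((A (i + 1) - A i) \<bullet> v)\<^sup>2 / (dist (A i) (A (i + 1)))\<^sup>2"
      by (simp add: c_def line_projection_def dist_norm norm_minus_commute dot_square_norm
          power_divide power_mult_distrib inner_commute power2_eq_square)
    then show "c i * dist (A i) (A (i + 1)) = ((A (i + 1) - A i) \<bullet> v)\<^sup>2 / dist (A i) (A (i + 1))"
      by (simp add: power2_eq_square)
  qed simp
  \<comment> \<open>The integral of a non-integrable function is 0, so in every case a bound on the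
    nonnegative integral carries over.\<close>
  finally show ?thesis
    unfolding set_lebesgue_integral_def
    by (rule integral_real_bounded[rotated]) (auto intro!: sum_nonneg divide_nonneg_nonneg)
qed

text \<open>Rayleigh quotients are nonnegative, so 0 bounds the set below; the admissible
  \<open>u\<close> makes it nonempty, without which \<open>Inf\<close> would say nothing.\<close>

lemma first_eigenvalue_le:
  assumes "(\<Sum>i=1..n. (u (A i))\<^sup>2) \<noteq> 0" "smooth u" "(\<Sum>i=1..n. u (A i)) = 0"
  shows "first_eigenvalue n A * (\<Sum>i=1..n. (u (A i))\<^sup>2)
    \<le> (LINT x:polygon_curve n A|hausdorff1. (norm (tangential_gradient n A u x))\<^sup>2)"
    and "0 \<le> first_eigenvalue n A"
proof -
  let ?E = "\<lambda>u. LINT x:polygon_curve n A|hausdorff1. (norm (tangential_gradient n A u x))\<^sup>2"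
  let ?R = "{?E u / (\<Sum>i=1..n. (u (A i))\<^sup>2) | u.
          smooth u \<and> (\<Sum>i=1..n. (u (A i))\<^sup>2) \<noteq> 0 \<and> (\<Sum>i=1..n. u (A i)) = 0}"
  have pos: "0 \<le> r" if "r \<in> ?R" for r
    using that by (auto simp: set_lebesgue_integral_def intro!: divide_nonneg_nonneg sum_nonneg integral_nonneg)
  have mem: "?E u / (\<Sum>i=1..n. (u (A i))\<^sup>2) \<in> ?R"
    using assms by blast
  have "first_eigenvalue n A \<le> ?E u / (\<Sum>i=1..n. (u (A i))\<^sup>2)"
    unfolding first_eigenvalue_def by (intro cInf_lower mem bdd_belowI[of _ 0] pos)
  moreover have "0 < (\<Sum>i=1..n. (u (A i))\<^sup>2)"
    using assms(1) by (simp add: order_less_le sum_nonneg)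
  ultimately show "first_eigenvalue n A * (\<Sum>i=1..n. (u (A i))\<^sup>2) \<le> ?E u"
    by (simp add: pos_le_divide_eq)
  show "0 \<le> first_eigenvalue n A"
    unfolding first_eigenvalue_def by (rule cInf_greatest) (use mem pos in auto)
qed

subsection \<open>Equality in the Reilly inequality\<close>

text \<open>Serves as summation by parts around the closed polygon.\<close>

lemma sum_cyclic_shift:
  fixes f :: "nat \<Rightarrow> 'b::comm_monoid_add"
  assumes "f 0 = f n"
  shows "(\<Sum>i=1..n. f (i - 1)) = (\<Sum>i=1..n. f i)"
proof -
  have "(\<Sum>i=1..n. f (i - 1)) = (\<Sum>i<n. f i)"
    by (rule sum.reindex_bij_witness[of _ Suc "\<lambda>i. i - 1"]) auto
  also have "\<dots> = (\<Sum>i=1..n. f i)"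
    using assms by (cases n) (simp_all add: sum.lessThan_Suc_shift lessThan_Suc_atMost atMost_atLeast0
        sum.shift_bounds_Suc_ivl sum.atLeast_Suc_atMost add.commute)
  finally show ?thesis .
qed

text \<open>Parseval in each summand; it adds the estimates for the single coordinates up to
  norms.\<close>

lemma sum_scaled_inner_basis:
  fixes f :: "nat \<Rightarrow> 'a::euclidean_space"
  shows "(\<Sum>b\<in>Basis. \<Sum>i\<in>I. (f i \<bullet> b)\<^sup>2 / c i) = (\<Sum>i\<in>I. (norm (f i))\<^sup>2 / c i)"
proof -
  have "(norm x)\<^sup>2 = (\<Sum>b\<in>Basis. (x \<bullet> b)\<^sup>2)" for x :: 'a
    unfolding power2_norm_eq_inner by (subst euclidean_inner) (simp add: power2_eq_square)
  then show ?thesis by (subst sum.swap) (simp add: sum_divide_distrib)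
qed

text \<open>The test functions are the coordinates centred at the barycentre \<open>g\<close>; summing over an
  orthonormal basis gives \<open>\<lambda> S \<le> L\<close> with \<open>S\<close> the moment of inertia about \<open>g\<close>.  The discrete first
  variation formula \<open>L = \<Sum> H\<^sub>i \<bullet> (A\<^sub>i - g)\<close> then turns equality in the Reilly inequality into
  equality in the Cauchy--Schwarz inequality.\<close>

lemma reilly_equality_curvature:
  fixes A :: "nat \<Rightarrow> 'a::euclidean_space"
  assumes poly: "polygon n A"
    and eq: "measure hausdorff1 (polygon_curve n A) * first_eigenvalue n A =
         (\<Sum>i=1..n. (norm (vertex_curvature A i))\<^sup>2)"
  obtains g c where "0 < c" "\<And>i. i \<in> {1..n} \<Longrightarrow> vertex_curvature A i = c *\<^sub>R (A i - g)"
proof -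
  have n: "3 \<le> n" and closed: "A (n + 1) = A 1" "A 0 = A n" using poly by (auto simp: polygon_def)
  \<comment> \<open>Two distinct vertices make the length \<open>L\<close> and the moment of inertia
    \<open>S\<close> positive.\<close>
  have "A 1 \<noteq> A 2"
  proof
    assume "A 1 = A 2"
    then have "A 1 \<in> closed_segment (A 2) (A (2 + 1))" by simp
    moreover have "1 \<in> {1..n}" "2 \<in> {1..n}" using n by auto
    ultimately have "(2::nat) = 1 \<or> 2 + 1 = (1::nat) \<or> ((1::nat) = 1 \<and> 2 = n)"
      using poly unfolding polygon_def by blast
    then show False using n by simp
  qed
  define l where "l i = dist (A i) (A (i + 1))" for i
  define L where "L = (\<Sum>i=1..n. l i)"
  define g where "g = (\<Sum>i=1..n. A i) /\<^sub>R real n"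
  define S where "S = (\<Sum>i=1..n. (norm (A i - g))\<^sup>2)"
  define H where "H = (\<Sum>i=1..n. (norm (vertex_curvature A i))\<^sup>2)"
  define \<Lambda> where "\<Lambda> = first_eigenvalue n A"
  have "0 < l 1" using \<open>A 1 \<noteq> A 2\<close> by (simp add: l_def numeral_2_eq_2)
  also have "l 1 \<le> L" unfolding L_def using n by (intro member_le_sum) (auto simp: l_def)
  finally have L: "0 < L" .
  have "S \<noteq> 0"
  proof
    assume "S = 0"
    then have "\<And>i. i \<in> {1..n} \<Longrightarrow> A i = g"
      unfolding S_def by (simp add: sum_nonneg_eq_0_iff)
    from this[of 1] this[of 2] n \<open>A 1 \<noteq> A 2\<close> show False by simp
  qed
  then have S: "0 < S" by (simp add: S_def order_less_le sum_nonneg)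
  have centred: "(\<Sum>i=1..n. (A i - g) \<bullet> b) = 0" for b
  proof -
    have "(\<Sum>i=1..n. A i) = real n *\<^sub>R g" using n by (simp add: g_def)
    then have "(\<Sum>i=1..n. A i - g) = 0"
      by (simp add: sum_subtractf sum_constant_scaleR)
    then show ?thesis by (simp add: inner_sum_left[symmetric])
  qed
  have "\<Lambda> * (\<Sum>i=1..n. ((A i - g) \<bullet> b)\<^sup>2) \<le> (\<Sum>i=1..n. ((A (i + 1) - A i) \<bullet> b)\<^sup>2 / l i)" for b
  proof (cases "(\<Sum>i=1..n. ((A i - g) \<bullet> b)\<^sup>2) = 0")
    \<comment> \<open>The coordinate vanishes at all vertices and is not admissible, but then the
      left side is 0.\<close>
    case True
    have "0 \<le> (\<Sum>i=1..n. ((A (i + 1) - A i) \<bullet> b)\<^sup>2 / l i)"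
      by (intro sum_nonneg) (auto simp: l_def)
    then show ?thesis using True by simp
  next
    case False
    show ?thesis
      unfolding \<Lambda>_def l_def
      by (rule order_trans[OF first_eigenvalue_le(1) affine_energy_le])
        (use False centred in \<open>simp_all add: smooth_affine\<close>)
  qed
  then have "(\<Sum>b\<in>Basis. \<Lambda> * (\<Sum>i=1..n. ((A i - g) \<bullet> b)\<^sup>2))
      \<le> (\<Sum>b\<in>Basis. \<Sum>i=1..n. ((A (i + 1) - A i) \<bullet> b)\<^sup>2 / l i)"
    by (intro sum_mono)
  also have "(\<Sum>b\<in>Basis. \<Lambda> * (\<Sum>i=1..n. ((A i - g) \<bullet> b)\<^sup>2)) = \<Lambda> * S"
    using sum_scaled_inner_basis[of "\<lambda>i. A i - g" "\<lambda>_. 1" "{1..n}"]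
    by (simp add: sum_distrib_left[symmetric] S_def)
  also have "(\<Sum>b\<in>Basis. \<Sum>i=1..n. ((A (i + 1) - A i) \<bullet> b)\<^sup>2 / l i) = L"
    unfolding sum_scaled_inner_basis L_def l_def
    by (intro sum.cong) (auto simp: dist_norm norm_minus_commute power2_eq_square)
  finally have eigenvalue: "\<Lambda> * S \<le> L" .
  \<comment> \<open>The measure of the curve is only known to be at most \<open>L\<close>;
    multiplying this bound by the eigenvalue needs the sign.\<close>
  have "0 \<le> \<Lambda>"
  proof -
    have "\<exists>b\<in>Basis. (\<Sum>i=1..n. ((A i - g) \<bullet> b)\<^sup>2) \<noteq> 0"
    proof (rule ccontr)
      assume "\<not> ?thesis"
      then have "(\<Sum>b\<in>Basis. \<Sum>i=1..n. ((A i - g) \<bullet> b)\<^sup>2 / 1) = 0" by simp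
      then show False using S unfolding sum_scaled_inner_basis S_def by simp
    qed
    then obtain b where "(\<Sum>i=1..n. ((A i - g) \<bullet> b)\<^sup>2) \<noteq> 0" by blast
    then show ?thesis
      unfolding \<Lambda>_def using centred by (rule first_eigenvalue_le(2)[OF _ smooth_affine])
  qed
  then have "H \<le> L * \<Lambda>"
    unfolding H_def eq[symmetric] \<Lambda>_def[symmetric] L_def l_def
    by (intro mult_right_mono measure_polygon_curve_le)
  define e where "e i = (A (i + 1) - A i) /\<^sub>R norm (A (i + 1) - A i)" for i
  have H_e: "vertex_curvature A i = e (i - 1) - e i" if "i \<in> {1..n}" for i
    using that by (simp add: vertex_curvature_def e_def norm_minus_commute[of "A i"] algebra_simps)
  have first_variation: "(\<Sum>i=1..n. vertex_curvature A i \<bullet> (A i - g)) = L"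
  proof -
    have "(\<Sum>i=1..n. vertex_curvature A i \<bullet> (A i - g))
        = (\<Sum>i=1..n. e (i - 1) \<bullet> (A (i - 1 + 1) - g)) - (\<Sum>i=1..n. e i \<bullet> (A i - g))"
      unfolding sum_subtractf[symmetric] by (intro sum.cong) (auto simp: H_e inner_diff_left)
    also have "(\<Sum>i=1..n. e (i - 1) \<bullet> (A (i - 1 + 1) - g)) = (\<Sum>i=1..n. e i \<bullet> (A (i + 1) - g))"
      by (rule sum_cyclic_shift) (use closed in \<open>simp add: e_def\<close>)
    also have "\<dots> - (\<Sum>i=1..n. e i \<bullet> (A i - g)) = L"
      unfolding sum_subtractf[symmetric] L_def
    proof (intro sum.cong refl)
      fix i
      have "e i \<bullet> (A (i + 1) - g) - e i \<bullet> (A i - g) = e i \<bullet> (A (i + 1) - A i)"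
        by (simp add: inner_diff_right)
      also have "\<dots> = l i"
        by (cases "A i = A (i + 1)")
          (simp_all add: e_def l_def dist_norm norm_minus_commute dot_square_norm power2_eq_square)
      finally show "e i \<bullet> (A (i + 1) - g) - e i \<bullet> (A i - g) = l i" .
    qed
    finally show ?thesis .
  qed
  \<comment> \<open>The least squares coefficient: it minimises the sum of squares that follows, and
    \<open>H * S \<le> L * (\<Lambda> * S) \<le> L * L\<close> forces the minimum to be 0.\<close>
  define c where "c = L / S"
  have "(\<Sum>i=1..n. (norm (vertex_curvature A i - c *\<^sub>R (A i - g)))\<^sup>2) = H - 2 * c * L + c\<^sup>2 * S"
    unfolding first_variation[symmetric] H_def S_def power2_norm_eq_inner
    by (simp add: inner_diff_left inner_diff_right inner_commute sum_subtractf sum.distrib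
        sum_distrib_left algebra_simps power2_eq_square)
  also have "\<dots> = H - L\<^sup>2 / S"
    using S by (simp add: c_def power2_eq_square field_simps)
  also have "\<dots> \<le> 0"
  proof -
    have "H * S \<le> L * (\<Lambda> * S)" using \<open>H \<le> L * \<Lambda>\<close> S by simp
    also have "\<dots> \<le> L * L" using eigenvalue L by simp
    finally show ?thesis using S by (simp add: pos_le_divide_eq power2_eq_square)
  qed
  finally have "(\<Sum>i=1..n. (norm (vertex_curvature A i - c *\<^sub>R (A i - g)))\<^sup>2) = 0"
    by (meson order_antisym sum_nonneg zero_le_power2)
  then have "\<And>i. i \<in> {1..n} \<Longrightarrow> vertex_curvature A i = c *\<^sub>R (A i - g)"
    by (simp add: sum_nonneg_eq_0_iff)
  moreover have "0 < c" using L S by (simp add: c_def)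
  ultimately show ?thesis using that by blast
qed

subsection \<open>Planarity\<close>

text \<open>With indices modulo \<open>n\<close> the wrap-around clause of \<open>polygon\<close>
  disappears, so later arguments may run over all naturals.\<close>

lemma polygon_cyclic_sides:
  assumes poly: "polygon n A"
  defines "P \<equiv> \<lambda>i. A (i mod n)"
  shows "i mod n \<noteq> j mod n \<Longrightarrow> open_segment (P i) (P (Suc i)) \<inter> closed_segment (P j) (P (Suc j)) = {}"
    and "P i \<in> closed_segment (P j) (P (Suc j)) \<Longrightarrow> j mod n = i mod n \<or> Suc j mod n = i mod n"
    and "i \<in> {1..n} \<Longrightarrow> A i = P i" and "i \<in> {1..n} \<Longrightarrow> A (i - 1) = P (i - 1)"
    and "i \<in> {1..n} \<Longrightarrow> A (i + 1) = P (Suc i)"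
proof -
  have n: "3 \<le> n" and closed: "A (n + 1) = A 1" "A 0 = A n" using poly by (auto simp: polygon_def)
  \<comment> \<open>The representative of \<open>i\<close> in \<open>{1..n}\<close>, so residue 0
    becomes \<open>n\<close>.\<close>
  define r where "r i = (if i mod n = 0 then n else i mod n)" for i
  have r: "r i \<in> {1..n}" "r i mod n = i mod n" "A (r i) = P i" "A (r i + 1) = P (Suc i)" for i
    using n closed by (auto simp: r_def P_def Suc_leI mod_Suc)
  show "open_segment (P i) (P (Suc i)) \<inter> closed_segment (P j) (P (Suc j)) = {}" if "i mod n \<noteq> j mod n"
  proof -
    have "r j \<noteq> r i" using that r(2) by metis
    then have "open_segment (A (r i)) (A (r i + 1)) \<inter> closed_segment (A (r j)) (A (r j + 1)) = {}"
      using poly r(1) unfolding polygon_def by blast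
    then show ?thesis by (simp only: r)
  qed
  show "j mod n = i mod n \<or> Suc j mod n = i mod n" if "P i \<in> closed_segment (P j) (P (Suc j))"
  proof -
    have "A (r i) \<in> closed_segment (A (r j)) (A (r j + 1))" using that by (simp only: r)
    then have "r j = r i \<or> r j + 1 = r i \<or> (r i = 1 \<and> r j = n)"
      using poly r(1) unfolding polygon_def by blast
    then show ?thesis
    proof (elim disjE conjE)
      assume "r j = r i" then show ?thesis using r(2) by metis
    next
      assume "r j + 1 = r i"
      then have "Suc (r j) mod n = i mod n" using r(2)[of i] by simp
      then show ?thesis using r(2)[of j] by (metis mod_Suc_eq)
    next
      assume "r i = 1" "r j = n"
      then have "i mod n = 1" "j mod n = 0" using r(2)[of i] r(2)[of j] n by auto
      then show ?thesis using n by (simp add: mod_Suc)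
    qed
  qed
  show "A i = P i" "A (i - 1) = P (i - 1)" "A (i + 1) = P (Suc i)" if "i \<in> {1..n}"
    using that n closed by (cases "i = n"; auto simp: P_def mod_Suc)+
qed

text \<open>The setting left by equality: \<open>balance\<close> is the curvature identity at the
  vertex \<open>P (Suc i)\<close>, written with unit side vectors.\<close>

locale critical_polygon =
  fixes n :: nat and P :: "nat \<Rightarrow> 'a::euclidean_space" and g :: 'a and c :: real
    and e :: "nat \<Rightarrow> 'a"
  assumes n: "3 \<le> n" and c: "0 < c"
    and periodic: "P (i + n) = P i"
    and e_def: "e i = (P (Suc i) - P i) /\<^sub>R norm (P (Suc i) - P i)"
    and balance: "e i - e (Suc i) = c *\<^sub>R (P (Suc i) - g)"
    and sides_disjoint: "i mod n \<noteq> j mod n \<Longrightarrow>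
      open_segment (P i) (P (Suc i)) \<inter> closed_segment (P j) (P (Suc j)) = {}"
    and vertex_on_side: "P i \<in> closed_segment (P j) (P (Suc j)) \<Longrightarrow>
      j mod n = i mod n \<or> Suc j mod n = i mod n"
begin

lemma mod_add_neq:
  assumes "0 < k" "k < n" shows "(i + k) mod n \<noteq> i mod n"
proof
  assume "(i + k) mod n = i mod n"
  then have "n dvd k" by (metis add_diff_cancel_left' le_add1 mod_eq_dvd_iff_nat)
  then show False using assms by (auto dest: dvd_imp_le)
qed

lemma Suc_neq: "Suc i mod n \<noteq> i mod n" and Suc_Suc_neq: "Suc (Suc i) mod n \<noteq> i mod n"
  using mod_add_neq[of 1 i] mod_add_neq[of 2 i] n by auto

text \<open>If neighbours coincided, \<open>P i\<close> would lie on side \<open>i + 1\<close>,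
  whose end indices both differ from \<open>i\<close> modulo \<open>n\<close>.\<close>

lemma side_nonzero: "P (Suc i) \<noteq> P i"
proof
  assume "P (Suc i) = P i"
  then have "P i \<in> closed_segment (P (Suc i)) (P (Suc (Suc i)))" by simp
  from vertex_on_side[OF this] show False using Suc_neq Suc_Suc_neq by metis
qed

definition side :: "nat \<Rightarrow> real" where "side i = norm (P (Suc i) - P i)"

lemma side_pos: "0 < side i"
  using side_nonzero by (simp add: side_def)

lemma side_vector: "P (Suc i) = P i + side i *\<^sub>R e i"
  using side_nonzero[of i] by (simp add: side_def e_def)

lemma norm_e: "norm (e i) = 1"
  using side_nonzero[of i] by (simp add: e_def)

text \<open>After a reversal the shorter of the two sides lies inside the longer, so a vertex lies
  on a side that it does not bound.\<close>

lemma no_backtracking: "e (Suc i) \<noteq> - e i"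
proof
  assume opp: "e (Suc i) = - e i"
  have shorter: "x - u *\<^sub>R v \<in> closed_segment x (x - t *\<^sub>R v)" if "0 \<le> u" "u \<le> t" "0 < t" for u t and x v :: 'a
    using that by (auto simp: in_segment algebra_simps intro!: exI[of _ "u / t"])
  have end1: "P (Suc (Suc i)) = P (Suc i) - side (Suc i) *\<^sub>R e i"
    using side_vector[of "Suc i"] opp by simp
  have end2: "P i = P (Suc i) - side i *\<^sub>R e i"
    using side_vector[of i] by simp
  consider "side (Suc i) \<le> side i" | "side i \<le> side (Suc i)" by linarith
  then show False
  proof cases
    case 1
    then have "P (Suc (Suc i)) \<in> closed_segment (P i) (P (Suc i))"
      unfolding end1 using shorter[of "side (Suc i)" "side i" "P (Suc i)" "e i"] side_pos[of i] side_pos[of "Suc i"]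
      by (simp add: end2[symmetric] closed_segment_commute)
    from vertex_on_side[OF this] show False using Suc_neq Suc_Suc_neq by metis
  next
    case 2
    then have "P i \<in> closed_segment (P (Suc i)) (P (Suc (Suc i)))"
      using shorter[of "side i" "side (Suc i)" "P (Suc i)" "e i"] side_pos[of i] side_pos[of "Suc i"]
      by (simp add: end1 end2[symmetric])
    from vertex_on_side[OF this] show False using Suc_neq Suc_Suc_neq by metis
  qed
qed

lemma recurrence: "e (Suc (Suc i)) = (2 - c * side (Suc i)) *\<^sub>R e (Suc i) - e i"
proof -
  have "(e (Suc i) - e (Suc (Suc i))) - (e i - e (Suc i)) = c *\<^sub>R (P (Suc (Suc i)) - P (Suc i))"
    unfolding balance by (simp add: algebra_simps)
  also have "\<dots> = (c * side (Suc i)) *\<^sub>R e (Suc i)"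
    by (simp add: side_vector[of "Suc i"])
  finally show ?thesis by (simp add: algebra_simps scaleR_2)
qed

text \<open>A flat first angle propagates: by the recurrence the next unit vector is plus or minus
  \<open>e 0\<close>, and reversal is excluded. All sides then point the same way and the polygon
  cannot close up.\<close>

lemma not_straight: "e 1 \<noteq> e 0"
proof
  assume straight: "e 1 = e 0"
  have "e i = e 0 \<and> e (Suc i) = e 0" for i
  proof (induction i)
    case 0 then show ?case using straight by simp
  next
    case (Suc i)
    then have parallel: "e (Suc (Suc i)) = (1 - c * side (Suc i)) *\<^sub>R e 0"
      using recurrence[of i] by (simp add: algebra_simps scaleR_2)
    then have "\<bar>1 - c * side (Suc i)\<bar> = 1"
      using norm_e[of "Suc (Suc i)"] norm_e[of 0] by simp
    moreover have "1 - c * side (Suc i) \<noteq> -1"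
      using no_backtracking[of "Suc i"] parallel Suc by auto
    ultimately show ?case using parallel Suc by (auto simp: abs_if split: if_splits)
  qed
  then have "e i \<bullet> e 0 = 1" for i
    by (metis dot_square_norm norm_e power_one)
  then have "P (Suc i) \<bullet> e 0 = P i \<bullet> e 0 + side i" for i
    using side_vector[of i] by (simp add: inner_add_left)
  then have "strict_mono (\<lambda>i. P i \<bullet> e 0)"
    using side_pos by (simp add: strict_mono_Suc_iff)
  then have "P 0 \<bullet> e 0 < P n \<bullet> e 0" using n strict_monoD[of "\<lambda>i. P i \<bullet> e 0" 0 n] by simp
  then show False using periodic[of 0] by simp
qed

end

section \<open>Complex coordinates in the plane of the polygon\<close>

definition frame :: "'a::euclidean_space \<Rightarrow> 'a \<Rightarrow> complex \<Rightarrow> 'a" where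
  "frame p q z = Re z *\<^sub>R p + Im z *\<^sub>R q"

lemma linear_frame: "linear (frame p q)"
  by (rule linearI) (simp_all add: frame_def algebra_simps)

lemma norm_frame:
  assumes "norm p = 1" "norm q = 1" "p \<bullet> q = 0"
  shows "norm (frame p q z) = cmod z"
proof -
  have "frame p q z \<bullet> frame p q z = (Re z)\<^sup>2 + (Im z)\<^sup>2"
    using assms[unfolded norm_eq_1] unfolding frame_def
    by (simp add: inner_add_left inner_add_right inner_commute power2_eq_square del: norm_eq_1
        power2_norm_eq_inner)
  then have "(norm (frame p q z))\<^sup>2 = (cmod z)\<^sup>2"
    by (simp add: cmod_power2 flip: power2_norm_eq_inner)
  then show ?thesis by (simp add: power2_eq_iff_nonneg)
qed

context critical_polygon
begin

text \<open>Gram-Schmidt on \<open>e 0\<close> and \<open>e 1\<close> gives the plane. The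
  recurrence keeps all side directions in it, and \<open>balance\<close> all vectors
  \<open>P i - g\<close>. The sign of \<open>q\<close> makes the first turn
  counterclockwise.\<close>

lemma planar_coordinates:
  obtains p q z w where
    "norm p = 1" "norm q = 1" "p \<bullet> q = 0"
    "\<And>i. P i = g + frame p q (z i)" "\<And>i. z (i + n) = z i" "\<And>i. w (i + n) = w i"
    "\<And>i. cmod (w i) = 1" "w 0 = 1" "0 < Im (w 1)"
    "\<And>i. of_real c * z (Suc i) = w i - w (Suc i)"
    "\<And>i. w (Suc (Suc i)) = of_real (2 - c * side (Suc i)) * w (Suc i) - w i"
proof -
  define p where "p = e 0"
  define v where "v = e 1 - (e 1 \<bullet> p) *\<^sub>R p"
  have p: "norm p = 1" "p \<bullet> p = 1" using norm_e[of 0] by (simp_all add: p_def dot_square_norm)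
  have "v \<noteq> 0"
  proof
    assume "v = 0"
    then have par: "e 1 = (e 1 \<bullet> p) *\<^sub>R p" by (simp add: v_def)
    then have "\<bar>e 1 \<bullet> p\<bar> = 1" using norm_e[of 1] p by (metis mult.right_neutral norm_scaleR)
    then have "e 1 = p \<or> e 1 = - p" using par by (auto simp: abs_if split: if_splits)
    then show False using not_straight no_backtracking[of 0] by (auto simp: p_def)
  qed
  define q where "q = v /\<^sub>R norm v"
  have q: "norm q = 1" "p \<bullet> q = 0"
    using \<open>v \<noteq> 0\<close> p by (simp_all add: q_def v_def inner_diff_right inner_commute)
  let ?J = "frame p q"
  interpret J: linear ?J by (rule linear_frame)
  note norm_J = norm_frame[OF p(1) q]
  have inj: "z = z'" if "?J z = ?J z'" for z z'
    using norm_J[of "z - z'"] that by (simp add: J.diff)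
  have scale_J: "r *\<^sub>R ?J z = ?J (of_real r * z)" for r z
    by (simp add: scaleR_conv_of_real[symmetric] J.scaleR)
  have e0: "e 0 = ?J 1" by (simp add: frame_def p_def)
  have e1: "e 1 = ?J (Complex (e 1 \<bullet> p) (norm v))"
    using \<open>v \<noteq> 0\<close> by (simp add: frame_def q_def v_def)
  have "(\<exists>\<omega>. e i = ?J \<omega>) \<and> (\<exists>\<omega>. e (Suc i) = ?J \<omega>)" for i
  proof (induction i)
    case 0 then show ?case using e0 e1 by auto
  next
    case (Suc i)
    then obtain \<omega> \<omega>' where "e i = ?J \<omega>" "e (Suc i) = ?J \<omega>'" by blast
    then have "e (Suc (Suc i)) = ?J (of_real (2 - c * side (Suc i)) * \<omega>' - \<omega>)"
      unfolding recurrence[of i] J.diff scale_J[symmetric] by simp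
    then show ?case using Suc by blast
  qed
  then obtain w where w: "\<And>i. e i = ?J (w i)" by metis
  have "\<exists>\<zeta>. P i - g = ?J \<zeta>" for i
  proof -
    have "P (Suc j) - g = ?J (of_real (1 / c) * (w j - w (Suc j)))" for j
    proof -
      have "?J (of_real (1 / c) * (w j - w (Suc j))) = (1 / c) *\<^sub>R (e j - e (Suc j))"
        by (simp only: scale_J[symmetric] J.diff w)
      then show ?thesis using c by (simp add: balance)
    qed
    \<comment> \<open>\<open>balance\<close> reaches only successor indices; adding a period makes
      every index one.\<close>
    from this[of "i + n - 1"] show ?thesis using n periodic[of i] by auto
  qed
  then obtain z where "\<And>i. P i - g = ?J (z i)" by metis
  then have z: "P i = g + ?J (z i)" for i by (metis add.commute diff_add_cancel)
  have e_periodic: "e (i + n) = e i" for i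
    using periodic[of i] periodic[of "Suc i"] by (simp add: e_def)
  show ?thesis
  proof (rule that[of p q z w])
    show "P i = g + ?J (z i)" for i by (rule z)
    show "z (i + n) = z i" for i using z[of i] z[of "i + n"] periodic[of i] by (simp add: inj)
    show "w (i + n) = w i" for i using w[of i] w[of "i + n"] e_periodic[of i] by (simp add: inj)
    show "cmod (w i) = 1" for i using norm_J[of "w i"] norm_e[of i] w[of i] by simp
    show "w 0 = 1" using e0 w[of 0] by (simp add: inj)
    have "w 1 = Complex (e 1 \<bullet> p) (norm v)" using e1 w[of 1] by (simp add: inj)
    then show "0 < Im (w 1)" using \<open>v \<noteq> 0\<close> by simp
    have "?J (of_real c * z (Suc i)) = c *\<^sub>R (P (Suc i) - g)" for i
      by (simp only: scale_J[symmetric]) (simp add: z)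
    then have "?J (of_real c * z (Suc i)) = ?J (w i - w (Suc i))" for i
      by (simp add: balance[symmetric] w J.diff)
    then show "of_real c * z (Suc i) = w i - w (Suc i)" for i by (rule inj)
    have "?J (w (Suc (Suc i))) = ?J (of_real (2 - c * side (Suc i)) * w (Suc i) - w i)" for i
      unfolding J.diff scale_J[symmetric] w[symmetric] by (rule recurrence)
    then show "w (Suc (Suc i)) = of_real (2 - c * side (Suc i)) * w (Suc i) - w i" for i by (rule inj)
  qed (use p q in auto)
qed

end

subsection \<open>Turning angles\<close>

lemma tan_minus_ii: "cos x \<noteq> 0 \<Longrightarrow> of_real (tan x) - \<i> = - \<i> * cis x / of_real (cos x)"
  by (auto simp: complex_eq_iff tan_def Re_divide_of_real Im_divide_of_real)

text \<open>Turns the difference \<open>w i - w (Suc i)\<close> into an offset along a tangent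
  line.\<close>

lemma tan_half_minus_ii: "cos (x / 2) \<noteq> 0 \<Longrightarrow> of_real (sin x) * (of_real (tan (x / 2)) - \<i>) = 1 - cis x"
  using sin_double[of "x / 2"] cos_double_sin[of "x / 2"]
  by (auto simp: complex_eq_iff tan_def power2_eq_square)

text \<open>The two tangents to a circle from a point are equally long; a rotation by
  \<open>2 * x\<close> carries one point of contact to the other.\<close>

lemma tan_minus_ii_reflect: "cos x \<noteq> 0 \<Longrightarrow> of_real (tan x) - \<i> = cis (2 * x) * (- of_real (tan x) - \<i>)"
  using tan_minus_ii[of x] tan_minus_ii[of "- x"] by (simp add: cis_mult)

text \<open>In complex coordinates of its plane, \<open>z i\<close> is the \<open>i\<close>-th vertex, \<open>w i\<close> the direction of the side
  from \<open>z i\<close> to \<open>z (i + 1)\<close>, and \<open>t i\<close> the turning angle at the vertex \<open>z (i + 1)\<close>.\<close>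

locale tangential_polygon =
  fixes n :: nat and P :: "nat \<Rightarrow> 'a::euclidean_space" and g p q :: 'a
    and z w :: "nat \<Rightarrow> complex" and t :: "nat \<Rightarrow> real" and a h :: real
  assumes n: "3 \<le> n" and h: "0 < h" and a: "0 < a" "a \<le> pi / 2"
    and frame: "norm p = 1" "norm q = 1" "p \<bullet> q = 0"
    and P: "P i = g + frame p q (z i)"
    and z_periodic: "z (i + n) = z i" and w_periodic: "w (i + n) = w i"
    and t_periodic: "t (i + n) = t i"
    and w_0: "w 0 = 1" and w_Suc: "w (Suc i) = w i * cis (t i)"
    and t: "t i = a \<or> t i = pi - a"
    and z_Suc: "z (Suc i) = of_real h * w i * (of_real (tan (t i / 2)) - \<i>)"
    and sides_disjoint: "i mod n \<noteq> j mod n \<Longrightarrow>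
      open_segment (P i) (P (Suc i)) \<inter> closed_segment (P j) (P (Suc j)) = {}"

text \<open>With \<open>v\<^sub>i = w\<^sub>i\<^sub>+\<^sub>1 / w\<^sub>i\<close> the recurrence becomes \<open>v\<^sub>i\<^sub>+\<^sub>1 + 1 / v\<^sub>i \<in> \<real>\<close>, so \<open>Im v\<^sub>i\<close> is
  constant.  This leaves two supplementary turning angles and puts all sides at the same distance
  \<open>h\<close> from the barycentre.\<close>

lemma (in critical_polygon) tangential_polygon:
  obtains p q z w t a h where "tangential_polygon n P g p q z w t a h"
proof -
  obtain p q z w where frame: "norm p = 1" "norm q = 1" "p \<bullet> q = 0"
    and P: "\<And>i. P i = g + frame p q (z i)"
    and periodic: "\<And>i. z (i + n) = z i" "\<And>i. w (i + n) = w i"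
    and w_norm: "\<And>i. cmod (w i) = 1" and w_0: "w 0 = 1" and im: "0 < Im (w 1)"
    and z: "\<And>i. of_real c * z (Suc i) = w i - w (Suc i)"
    and rec: "\<And>i. w (Suc (Suc i)) = of_real (2 - c * side (Suc i)) * w (Suc i) - w i"
    using planar_coordinates by blast
  define v where "v i = w (Suc i) * cnj (w i)" for i
  have unit: "w i * cnj (w i) = 1" for i
    using w_norm[of i] by (simp add: complex_norm_square[symmetric])
  have w_Suc: "w (Suc i) = w i * v i" for i
    using unit[of i] by (simp add: v_def mult.left_commute)
  have v_norm: "cmod (v i) = 1" for i by (simp add: v_def norm_mult w_norm)
  \<comment> \<open>The recurrence times \<open>cnj (w (Suc i))\<close>, the inverse of
    \<open>w (Suc i)\<close> on the unit circle.\<close>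
  have v_Suc: "v (Suc i) = of_real (2 - c * side (Suc i)) - cnj (v i)" for i
  proof -
    have "v (Suc i) = of_real (2 - c * side (Suc i)) * (w (Suc i) * cnj (w (Suc i))) - w i * cnj (w (Suc i))"
      unfolding v_def rec[of i] by (simp add: algebra_simps)
    then show ?thesis by (simp only: unit) (simp add: v_def)
  qed
  define s where "s = Im (w 1)"
  have Im_v: "Im (v i) = s" for i
  proof (induction i)
    case 0 then show ?case by (simp add: v_def s_def w_0)
  next
    case (Suc i) then show ?case using v_Suc[of i] by simp
  qed
  have s: "0 < s" "s \<le> 1"
    using im abs_Im_le_cmod[of "w 1"] w_norm[of 1] by (auto simp: s_def)
  \<comment> \<open>Of the two supplementary angles with sine \<open>s\<close>, the one at most
    \<open>pi / 2\<close>.\<close>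
  define a where "a = arcsin s"
  have a: "0 < a" "a \<le> pi / 2" "sin a = s"
    using s arcsin_less_arcsin[of 0 s] arcsin_bounded[of s] by (auto simp: a_def)
  have v_cases: "v i = cis a \<or> v i = cis (pi - a)" for i
  proof -
    have "(Re (v i))\<^sup>2 + s\<^sup>2 = 1"
      using v_norm[of i] cmod_power2[of "v i"] Im_v[of i] by simp
    then have "(Re (v i))\<^sup>2 = (cos a)\<^sup>2"
      using sin_cos_squared_add[of a] a(3) by simp
    then have "Re (v i) = cos a \<or> Re (v i) = - cos a" by (simp add: power2_eq_iff)
    then show ?thesis using Im_v[of i] a(3) by (auto simp: complex_eq_iff)
  qed
  define t where "t i = (if v i = cis a then a else pi - a)" for i
  have t: "t i = a \<or> t i = pi - a" "v i = cis (t i)" for i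
    using v_cases[of i] by (auto simp: t_def)
  have sin_t: "sin (t i) = s" for i using t(1)[of i] a(3) by auto
  have t_bounds: "0 < t i" "t i < pi" for i using t(1)[of i] a pi_gt_zero by (auto; linarith)+
  have cos_t: "cos (t i / 2) \<noteq> 0" for i
    using t_bounds[of i] cos_gt_zero[of "t i / 2"] by simp
  \<comment> \<open>Since \<open>sin (t i) = s\<close> for all \<open>i\<close>, dividing
    \<open>c * z (Suc i)\<close> by \<open>c\<close> yields the common tangent distance
    \<open>s / c\<close>.\<close>
  have "tangential_polygon n P g p q z w t a (s / c)"
  proof
    fix i
    show "z (Suc i) = of_real (s / c) * w i * (of_real (tan (t i / 2)) - \<i>)"
    proof -
      have "of_real c * z (Suc i) = w i * (of_real (sin (t i)) * (of_real (tan (t i / 2)) - \<i>))"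
        unfolding z tan_half_minus_ii[OF cos_t] by (simp add: w_Suc t(2) algebra_simps)
      then show ?thesis using c by (simp add: sin_t field_simps)
    qed
    show "t (i + n) = t i"
      using periodic(2)[of i] periodic(2)[of "Suc i"] by (simp add: t_def v_def)
  qed (use n c s a frame P periodic w_0 w_Suc t sides_disjoint in auto)
  then show ?thesis using that by blast
qed

section \<open>Tangency to a circle and the total turning\<close>

context tangential_polygon
begin

lemma t_bounds: "0 < t i" "t i < pi"
  using t[of i] a pi_gt_zero by (auto; linarith)+

lemma tan_half_pos: "0 < tan (t i / 2)"
  using t_bounds[of i] by (intro tan_gt_zero) auto

lemma cos_half: "cos (t i / 2) \<noteq> 0"
  using t_bounds[of i] cos_gt_zero[of "t i / 2"] by simp

text \<open>The vertex ending side \<open>i\<close> as seen from side \<open>i + 1\<close>: the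
  tangent length is the same, with opposite sign.\<close>

lemma z_Suc': "z (Suc i) = of_real h * w (Suc i) * (- of_real (tan (t i / 2)) - \<i>)"
  unfolding z_Suc w_Suc tan_minus_ii_reflect[OF cos_half] by (simp add: mult.assoc)

lemma period: "z (i + n * k) = z i" "t (i + n * k) = t i"
  by (induction k; simp add: z_periodic t_periodic add.assoc[symmetric] add.commute[of n])+

text \<open>An argument of \<open>w i\<close> that keeps count of full turns.\<close>

definition \<phi> :: "nat \<Rightarrow> real" where "\<phi> i = (\<Sum>j<i. t j)"

lemma \<phi>_0: "\<phi> 0 = 0" and \<phi>_Suc: "\<phi> (Suc i) = \<phi> i + t i"
  by (simp_all add: \<phi>_def)

lemma \<phi>_strict_mono: "strict_mono \<phi>"
  using t_bounds by (simp add: strict_mono_Suc_iff \<phi>_Suc)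

lemma w_cis: "w i = cis (\<phi> i)"
  by (induction i) (simp_all add: w_0 w_Suc \<phi>_0 \<phi>_Suc cis_mult)

lemma \<phi>_period: "\<phi> (i + n * k) = \<phi> i + real k * \<phi> n"
proof -
  have "\<phi> (i + n) = \<phi> i + \<phi> n" for i
    by (induction i) (simp_all add: \<phi>_0 \<phi>_Suc t_periodic)
  then show ?thesis
    by (induction k) (simp_all add: algebra_simps, metis add.assoc add.commute)
qed

text \<open>Side \<open>i + 1\<close> lies on a tangent line of the circle of radius
  \<open>h\<close> about \<open>g\<close>; \<open>\<tau>\<close> is the signed offset from the point
  of contact in units of \<open>h\<close>, running from \<open>- tan (t i / 2)\<close> to
  \<open>tan (t (Suc i) / 2)\<close>.\<close>

lemma on_side:
  assumes x: "x = g + frame p q (of_real h * w (Suc i) * (of_real \<tau> - \<i>))"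
  shows "- tan (t i / 2) \<le> \<tau> \<Longrightarrow> \<tau> \<le> tan (t (Suc i) / 2) \<Longrightarrow> x \<in> closed_segment (P (Suc i)) (P (Suc (Suc i)))"
    and "- tan (t i / 2) < \<tau> \<Longrightarrow> \<tau> < tan (t (Suc i) / 2) \<Longrightarrow> x \<in> open_segment (P (Suc i)) (P (Suc (Suc i)))"
proof -
  interpret J: linear "frame p q" by (rule linear_frame)
  let ?F = "\<lambda>r. g + frame p q (of_real h * w (Suc i) * (of_real r - \<i>))"
  have ends: "P (Suc i) = ?F (- tan (t i / 2))" "P (Suc (Suc i)) = ?F (tan (t (Suc i) / 2))"
    unfolding P z_Suc'[of i] z_Suc[of "Suc i"] by simp_all
  have F: "?F r = ?F 0 + r *\<^sub>R frame p q (of_real h * w (Suc i))" for r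
  proof -
    have "of_real h * w (Suc i) * (of_real r - \<i>)
        = of_real h * w (Suc i) * (of_real 0 - \<i>) + r *\<^sub>R (of_real h * w (Suc i))"
      by (simp add: scaleR_conv_of_real algebra_simps)
    then show ?thesis by (simp only: J.add J.scaleR add.assoc)
  qed
  define u where "u = (\<tau> + tan (t i / 2)) / (tan (t (Suc i) / 2) + tan (t i / 2))"
  have pos: "0 < tan (t (Suc i) / 2) + tan (t i / 2)"
    using tan_half_pos[of i] tan_half_pos[of "Suc i"] by simp
  have \<tau>: "\<tau> = (1 - u) * (- tan (t i / 2)) + u * tan (t (Suc i) / 2)"
  proof -
    have "u * (tan (t (Suc i) / 2) + tan (t i / 2)) = \<tau> + tan (t i / 2)"
      using pos by (simp add: u_def)
    then show ?thesis by (simp add: algebra_simps)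
  qed
  have x_eq: "x = (1 - u) *\<^sub>R P (Suc i) + u *\<^sub>R P (Suc (Suc i))"
    unfolding ends x F[of \<tau>] F[of "- tan (t i / 2)"] F[of "tan (t (Suc i) / 2)"]
    by (subst \<tau>) (simp add: algebra_simps)
  have u01: "0 \<le> u \<longleftrightarrow> - tan (t i / 2) \<le> \<tau>" "0 < u \<longleftrightarrow> - tan (t i / 2) < \<tau>"
    "u \<le> 1 \<longleftrightarrow> \<tau> \<le> tan (t (Suc i) / 2)" "u < 1 \<longleftrightarrow> \<tau> < tan (t (Suc i) / 2)"
    using pos by (auto simp: u_def zero_le_divide_iff zero_less_divide_iff divide_le_eq_1 divide_less_eq_1)
  show "x \<in> closed_segment (P (Suc i)) (P (Suc (Suc i)))"
    if "- tan (t i / 2) \<le> \<tau>" "\<tau> \<le> tan (t (Suc i) / 2)"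
    using that u01 x_eq by (auto simp: in_segment)
  have "frame p q (of_real h * w (Suc i)) \<noteq> 0"
    using norm_frame[OF frame, of "of_real h * w (Suc i)"] h by (auto simp: w_cis norm_mult)
  then have "P (Suc i) \<noteq> P (Suc (Suc i))"
    unfolding ends F[of "- tan (t i / 2)"] F[of "tan (t (Suc i) / 2)"] using pos
    by (metis add_left_cancel add.left_inverse less_irrefl scaleR_right_imp_eq)
  then show "x \<in> open_segment (P (Suc i)) (P (Suc (Suc i)))"
    if "- tan (t i / 2) < \<tau>" "\<tau> < tan (t (Suc i) / 2)"
    using that u01 x_eq by (auto simp: in_segment)
qed

text \<open>If the polygon winds around its incircle at least twice, then some side \<open>j\<close> has its point of
  tangency one full turn after that of side \<open>i\<close>, up to an angle \<open>\<delta>\<close> smaller than the turning angles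
  after \<open>i\<close> and before \<open>j\<close>; then these two sides meet.\<close>

lemma total_turning: "\<phi> n = 2 * pi"
proof (rule ccontr)
  assume ne: "\<phi> n \<noteq> 2 * pi"
  have "cis (\<phi> n) = 1" using w_cis[of n] w_periodic[of 0] w_0 by simp
  then have "cos (\<phi> n) = 1" by (metis cis.sel(1) one_complex.sel(1))
  then obtain k :: int where k: "\<phi> n = of_int k * 2 * pi"
    by (auto simp: cos_one_2pi_int)
  have "0 < \<phi> n" using strict_monoD[OF \<phi>_strict_mono, of 0 n] n by (simp add: \<phi>_0)
  then have "0 < k" using k by (simp add: zero_less_mult_iff)
  moreover have "k \<noteq> 1" using k ne by auto
  ultimately have "2 \<le> real_of_int k" by linarith
  then have twice: "4 * pi \<le> \<phi> n" using k mult_right_mono[of 2 "real_of_int k" "2 * pi"] by simp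
  \<comment> \<open>The first side at least a full turn past side 1. Starting at 1 and not 0 gives
    the side \<open>Suc i\<close> found later a predecessor, as \<open>on_side\<close>
    demands.\<close>
  define j where "j = (LEAST j. \<phi> 1 + 2 * pi \<le> \<phi> j)"
  have "\<phi> 1 + 2 * pi \<le> \<phi> (1 + n * 1)" using twice pi_gt_zero \<phi>_period[of 1 1] by linarith
  then have j: "\<phi> 1 + 2 * pi \<le> \<phi> j" unfolding j_def by (rule LeastI)
  have j_min: "\<phi> m < \<phi> 1 + 2 * pi" if "m < j" for m
    using not_less_Least[OF that[unfolded j_def]] by simp
  \<comment> \<open>The first side less than a full turn before side \<open>j\<close>; the side just
    before it is the one that meets side \<open>j\<close>.\<close>
  define m where "m = (LEAST m. \<phi> j < \<phi> m + 2 * pi)"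
  have m: "\<phi> j < \<phi> m + 2 * pi" unfolding m_def by (rule LeastI[of _ j]) simp
  have m_min: "\<phi> i + 2 * pi \<le> \<phi> j" if "i < m" for i
    using not_less_Least[OF that[unfolded m_def]] by simp
  have mono: "\<phi> x < \<phi> y \<longleftrightarrow> x < y" "\<phi> x \<le> \<phi> y \<longleftrightarrow> x \<le> y" for x y
    using \<phi>_strict_mono by (simp_all add: strict_mono_less strict_mono_less_eq)
  have "\<phi> 1 < \<phi> j" using j pi_gt_zero by linarith
  then obtain j' where j': "j = Suc (Suc j')" by (metis One_nat_def less_imp_Suc_add mono(1) plus_1_eq_Suc add_Suc)
  have "\<phi> 1 < \<phi> m" using m j by linarith
  then obtain i where i: "m = Suc (Suc i)" by (metis One_nat_def less_imp_Suc_add mono(1) plus_1_eq_Suc add_Suc)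
  define \<delta> where "\<delta> = \<phi> j - \<phi> (Suc i) - 2 * pi"
  have \<delta>: "0 \<le> \<delta>" "\<delta> < t (Suc i)" "\<delta> < t (Suc j')"
  proof -
    show "0 \<le> \<delta>" using m_min[of "Suc i"] by (simp add: \<delta>_def i)
    show "\<delta> < t (Suc i)" using m \<phi>_Suc[of "Suc i"] by (simp add: \<delta>_def i)
    have "\<phi> 1 \<le> \<phi> (Suc i)" by (simp add: mono)
    then show "\<delta> < t (Suc j')" using j_min[of "Suc j'"] \<phi>_Suc[of "Suc j'"] by (simp add: \<delta>_def j')
  qed
  \<comment> \<open>Tangents whose points of contact are \<open>\<delta>\<close> apart meet at
    offset \<open>T\<close> on the earlier line and \<open>- T\<close> on the later one.\<close>
  define T where "T = tan (\<delta> / 2)"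
  have tan_less: "T < tan (t r / 2)" if "\<delta> < t r" for r
    unfolding T_def using that t_bounds[of r] \<delta>(1) by (intro tan_monotone) auto
  have "0 \<le> T" unfolding T_def using \<delta> t_bounds[of "Suc i"]
    by (cases "\<delta> = 0") (auto intro!: less_imp_le[OF tan_gt_zero])
  define x where "x = g + frame p q (of_real h * w (Suc i) * (of_real T - \<i>))"
  have "x \<in> open_segment (P (Suc i)) (P (Suc (Suc i)))"
    by (rule on_side(2)[OF x_def]) (use tan_half_pos[of i] \<open>0 \<le> T\<close> tan_less[OF \<delta>(2)] in auto)
  moreover have "x \<in> closed_segment (P j) (P (Suc j))"
  proof -
    have "\<phi> j = \<phi> (Suc i) + (2 * pi + \<delta>)" by (simp add: \<delta>_def)
    then have "w j = w (Suc i) * cis \<delta>"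
      by (simp add: w_cis cis_mult[symmetric])
    moreover have "cos (\<delta> / 2) \<noteq> 0"
      using \<delta> t_bounds[of "Suc i"] cos_gt_zero_pi[of "\<delta> / 2"] by simp
    ultimately have x: "x = g + frame p q (of_real h * w (Suc (Suc j')) * (of_real (- T) - \<i>))"
      unfolding x_def T_def tan_minus_ii_reflect[OF \<open>cos (\<delta> / 2) \<noteq> 0\<close>] by (simp add: j' mult.assoc)
    show ?thesis
      unfolding j' by (rule on_side(1)[OF x])
        (use tan_less[OF \<delta>(3)] tan_half_pos[of "Suc (Suc j')"] \<open>0 \<le> T\<close> in auto)
  qed
  ultimately have "Suc i mod n = j mod n"
    using sides_disjoint[of "Suc i" j] by blast
  moreover have "Suc i < j"
    unfolding mono(1)[symmetric] using \<delta>(1) pi_gt_zero unfolding \<delta>_def by linarith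
  \<comment> \<open>Distinct indices of the same side differ by whole periods, so by at least
    \<open>4 * pi\<close> of turning, but these two are less than \<open>3 * pi\<close>
    apart.\<close>
  ultimately obtain k where "j = Suc i + n * k"
    by (metis dvd_def le_add_diff_inverse less_imp_le_nat mod_eq_dvd_iff_nat)
  then have "\<phi> j = \<phi> (Suc i) + real k * \<phi> n" and "k \<noteq> 0"
    using \<open>Suc i < j\<close> by (auto simp: \<phi>_period simp del: add_Suc)
  moreover have "\<phi> n \<le> real k * \<phi> n"
    using \<open>k \<noteq> 0\<close> \<open>0 < \<phi> n\<close> by simp
  ultimately show False
    using \<delta>(2) t_bounds(2)[of "Suc i"] twice pi_gt_zero unfolding \<delta>_def by linarith
qed

end

subsection \<open>Classification\<close>

text \<open>At \<open>B 1\<close> and at \<open>B (p + 1)\<close> one side vector times the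
  conjugate of the other is \<open>- 2 * cnj \<zeta>\<close> with
  \<open>\<zeta> = cis \<alpha>\<close>, so the cosine of the angle is
  \<open>- cos \<alpha>\<close>.\<close>

lemma fake_regular_polygon_standard:
  assumes "2 \<le> p"
  defines "\<alpha> \<equiv> pi / real p"
  defines "B \<equiv> \<lambda>k. if k = 0 then - \<i> * of_real (cot (\<alpha> / 2)) else cis (real (k - 1) * \<alpha>)"
  shows "fake_regular_polygon p B"
proof -
  have \<alpha>: "0 < \<alpha>" "\<alpha> \<le> pi / 2" "real p * \<alpha> = pi"
    using assms(1) by (auto simp: \<alpha>_def field_simps)
  define \<zeta> where "\<zeta> = cis \<alpha>"
  have sin0: "sin (\<alpha> / 2) \<noteq> 0" using \<alpha> pi_gt_zero by (intro less_imp_neq[symmetric] sin_gt_zero) linarith+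
  have "\<zeta> \<noteq> 1"
    using sin_gt_zero[of \<alpha>] \<alpha> pi_gt_zero by (auto simp: \<zeta>_def complex_eq_iff)
  have last: "cis (real p * \<alpha>) = -1" using \<alpha>(3) by simp
  have B0: "B 0 = - (1 + \<zeta>) / (1 - \<zeta>)"
  proof -
    have "sin \<alpha> = 2 * sin (\<alpha> / 2) * cos (\<alpha> / 2)" "1 - cos \<alpha> = 2 * (sin (\<alpha> / 2))\<^sup>2"
      "1 + cos \<alpha> = 2 * (cos (\<alpha> / 2))\<^sup>2"
      using sin_double[of "\<alpha> / 2"] cos_double_sin[of "\<alpha> / 2"] cos_double_cos[of "\<alpha> / 2"] by simp_all
    then have "cot (\<alpha> / 2) * sin \<alpha> = 1 + cos \<alpha>" "cot (\<alpha> / 2) * (1 - cos \<alpha>) = sin \<alpha>"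
      using sin0 by (simp_all add: cot_def power2_eq_square)
    then have "\<i> * of_real (cot (\<alpha> / 2)) * (1 - \<zeta>) = 1 + \<zeta>"
      by (simp add: \<zeta>_def complex_eq_iff)
    then have "B 0 * (1 - \<zeta>) = - (1 + \<zeta>)" by (simp add: B_def)
    then show ?thesis using \<open>\<zeta> \<noteq> 1\<close> by (simp add: nonzero_eq_divide_eq)
  qed
  have B1: "B 1 = 1" "B 2 = \<zeta>" "B (p + 1) = - 1"
    using last by (simp_all add: B_def \<zeta>_def)
  have unit: "\<zeta> * cnj \<zeta> = 1" "cnj \<zeta> \<noteq> 1"
    using \<open>\<zeta> \<noteq> 1\<close> by (simp add: \<zeta>_def cis_mult cis_cnj) (metis \<open>\<zeta> \<noteq> 1\<close> complex_cnj_cnj complex_cnj_one)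
  have conj: "1 - cnj \<zeta> = - cnj \<zeta> * (1 - \<zeta>)"
    using unit(1) by (simp add: algebra_simps)
  have Bp: "B p = - cnj \<zeta>"
  proof -
    have "cis (real (p - 1) * \<alpha>) = cis (real p * \<alpha>) * cis (- \<alpha>)"
      using assms(1) by (simp add: cis_mult of_nat_diff algebra_simps)
    then show ?thesis using assms(1) last by (simp add: B_def \<zeta>_def cis_cnj)
  qed
  have arc: "arccos (- cos \<alpha>) = (1 - 1 / real p) * pi"
  proof -
    have "arccos (cos (pi - \<alpha>)) = pi - \<alpha>" using \<alpha> by (intro arccos_cos) auto
    then show ?thesis by (simp add: \<alpha>_def algebra_simps)
  qed
  have inner: "u \<bullet> v = Re (u * cnj v)" for u v :: complex
    by (simp add: inner_complex_def)
  have angle: "vertex_angle x y v = (1 - 1 / real p) * pi"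
    if "(x - y) \<bullet> (v - y) = - 2 * cos \<alpha>" "norm (x - y) * norm (v - y) = 2" for x y v :: complex
    unfolding vertex_angle_def that using arc by simp
  have first: "vertex_angle (B 0) (B 1) (B 2) = (1 - 1 / real p) * pi"
  proof (rule angle)
    have d: "B 0 - B 1 = - 2 / (1 - \<zeta>)" "B 2 - B 1 = - (1 - \<zeta>)"
      using \<open>\<zeta> \<noteq> 1\<close> unfolding B0 B1 by (simp_all add: field_simps)
    have "cnj (B 2 - B 1) = cnj \<zeta> * (1 - \<zeta>)"
      using unit(1) unfolding d by (simp add: algebra_simps)
    then have "(B 0 - B 1) * cnj (B 2 - B 1) = - 2 * cnj \<zeta>"
      unfolding d(1) using \<open>\<zeta> \<noteq> 1\<close> by simp
    then show "(B 0 - B 1) \<bullet> (B 2 - B 1) = - 2 * cos \<alpha>"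
      unfolding inner by (simp add: \<zeta>_def)
    show "norm (B 0 - B 1) * norm (B 2 - B 1) = 2"
      unfolding d norm_minus_cancel norm_divide using \<open>\<zeta> \<noteq> 1\<close> by simp
  qed
  have second: "vertex_angle (B p) (B (p + 1)) (B 0) = (1 - 1 / real p) * pi"
  proof (rule angle)
    have d: "B p - B (p + 1) = 1 - cnj \<zeta>" "B 0 - B (p + 1) = 2 / (1 - cnj \<zeta>)"
    proof -
      show "B p - B (p + 1) = 1 - cnj \<zeta>" unfolding Bp B1 by simp
      have "B 0 - B (p + 1) = - 2 * \<zeta> / (1 - \<zeta>)"
        using \<open>\<zeta> \<noteq> 1\<close> unfolding B0 B1 by (simp add: field_simps)
      also have "\<dots> = 2 / (1 - cnj \<zeta>)"
      proof (subst frac_eq_eq)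
        show "- 2 * \<zeta> * (1 - cnj \<zeta>) = 2 * (1 - \<zeta>)"
          using unit(1) by (simp add: algebra_simps)
      qed (use \<open>\<zeta> \<noteq> 1\<close> unit(2) in auto)
      finally show "B 0 - B (p + 1) = 2 / (1 - cnj \<zeta>)" .
    qed
    have "(B p - B (p + 1)) * cnj (B 0 - B (p + 1)) = (- cnj \<zeta> * (1 - \<zeta>)) * (2 / (1 - \<zeta>))"
      unfolding d conj[symmetric] by simp
    also have "\<dots> = - 2 * cnj \<zeta>" using \<open>\<zeta> \<noteq> 1\<close> by simp
    finally have "(B p - B (p + 1)) * cnj (B 0 - B (p + 1)) = - 2 * cnj \<zeta>" .
    then show "(B p - B (p + 1)) \<bullet> (B 0 - B (p + 1)) = - 2 * cos \<alpha>"
      unfolding inner by (simp add: \<zeta>_def)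
    show "norm (B p - B (p + 1)) * norm (B 0 - B (p + 1)) = 2"
      unfolding d norm_divide using unit(2) by simp
  qed
  have "dist (B 0) (B 1) = dist (B 0) (B (p + 1))"
    unfolding B1 by (simp add: B_def dist_norm norm_complex_def)
  moreover have "\<forall>k\<in>{2..p + 1}. B k = 0 + cis (real (k - 1) * pi / real p) * (B 1 - 0)"
    by (auto simp: B_def \<alpha>_def)
  moreover have "dist (B 1) 0 = 1" unfolding B1 by simp
  ultimately show ?thesis
    unfolding fake_regular_polygon_def using first second assms(1) by blast
qed

section \<open>Recognising the model polygons\<close>

context tangential_polygon
begin

text \<open>Since \<open>frame p q\<close> is isometric, multiplication by \<open>K\<close> followed
  by it is a similarity of ratio \<open>cmod K\<close>.\<close>

lemma similar_to_planarI:
  assumes A: "\<And>i. i \<in> {1..n} \<Longrightarrow> A i = P i"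
    and K: "K \<noteq> 0" and B: "\<And>k. k < n \<Longrightarrow> z (m + k) = K * B k"
  shows "similar_to_planar n A B"
proof -
  interpret J: linear "frame p q" by (rule linear_frame)
  define f where "f x = g + frame p q (K * x)" for x
  \<comment> \<open>Congruent to \<open>- m\<close> modulo \<open>n\<close>, without subtracting
    \<open>m\<close> in the naturals.\<close>
  define s where "s = (n - 1) * m"
  have "dist (f x) (f y) = cmod K * dist x y" for x y
    by (simp add: f_def dist_norm J.diff[symmetric] norm_frame[OF frame] right_diff_distrib[symmetric] norm_mult)
  moreover have "A i = f (B ((s + i) mod n))" if "i \<in> {1..n}" for i
  proof -
    have "i + n * m = m + (s + i)" using n by (cases n) (simp_all add: s_def)
    also have "\<dots> = m + (s + i) mod n + n * ((s + i) div n)" by simp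
    finally have "z (i + n * m) = z (m + (s + i) mod n + n * ((s + i) div n))" by (rule arg_cong)
    then have "z i = z (m + (s + i) mod n)" unfolding period .
    then show ?thesis
      using A[OF that] n by (simp add: f_def P B)
  qed
  ultimately show ?thesis
    unfolding similar_to_planar_def using K by (intro exI[of _ f] exI[of _ "cmod K"] exI[of _ s]) auto
qed

lemma h_tan_neq_0: "of_real h * w i * (of_real r - \<i>) \<noteq> 0"
proof -
  have "of_real r - \<i> \<noteq> 0" by (simp add: complex_eq_iff)
  then show ?thesis using h by (simp add: w_cis)
qed

text \<open>Total turning fixes \<open>\<tau> = 2 * pi / n\<close>, and all vertices are rotated
  copies of \<open>z 1\<close>.\<close>

lemma regular_polygonI:
  assumes A: "\<And>i. i \<in> {1..n} \<Longrightarrow> A i = P i" and \<tau>: "\<And>i. i < n \<Longrightarrow> t i = \<tau>"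
  shows "regular_polygon n A"
  unfolding regular_polygon_def
proof (rule similar_to_planarI[where m = 1])
  have "real n * \<tau> = 2 * pi"
    using total_turning \<tau> by (simp add: \<phi>_def)
  then have \<tau>_eq: "\<tau> = 2 * pi / real n" using n by (simp add: field_simps)
  have \<phi>: "\<phi> k = real k * \<tau>" if "k < n" for k
    using that \<tau> by (simp add: \<phi>_def)
  show "z (1 + k) = of_real h * w 0 * (of_real (tan (\<tau> / 2)) - \<i>) * cis (2 * pi * real k / real n)" if "k < n" for k
    using z_Suc[of k] that by (simp add: \<tau> w_cis \<phi> \<tau>_eq \<phi>_0 mult.commute mult.left_commute)
qed (use A h_tan_neq_0 in auto)

text \<open>The exceptional turning angle sits at \<open>z (Suc v)\<close>, which becomes
  \<open>B 0\<close>; the other vertices follow on a circle about \<open>g\<close> in steps of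
  \<open>a\<close>.\<close>

lemma fake_regularI:
  assumes A: "\<And>i. i \<in> {1..n} \<Longrightarrow> A i = P i"
    and v: "t v = pi - a" "\<And>k. 0 < k \<Longrightarrow> k < n \<Longrightarrow> t (v + k) = a"
    and n_a: "real (n - 2) * a = pi"
  shows "\<exists>p\<ge>2. \<exists>B. n = p + 2 \<and> fake_regular_polygon p B \<and> similar_to_planar (p + 2) A B"
proof -
  define p where "p = n - 2"
  have p: "n = p + 2" using n by (simp add: p_def)
  have "0 < p" using n by (simp add: p_def)
  then have a_eq: "a = pi / real p" using n_a by (simp add: p_def field_simps)
  have "2 \<le> p"
  proof (rule ccontr)
    assume "\<not> 2 \<le> p" then have "p = 1" using \<open>0 < p\<close> by simp
    then show False using a_eq a pi_gt_zero by simp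
  qed
  define B where "B k = (if k = 0 then - \<i> * of_real (cot (a / 2)) else cis (real (k - 1) * a))" for k
  \<comment> \<open>This is \<open>z (v + 2)\<close>, the image of \<open>B 1 = 1\<close>.\<close>
  define K where "K = of_real h * w (Suc v) * (of_real (tan (a / 2)) - \<i>)"
  have w: "w (Suc v + k) = w (Suc v) * cis (real k * a)" if "Suc k < n" for k
    using that
  proof (induction k)
    case (Suc k)
    then show ?case using w_Suc[of "Suc v + k"] v(2)[of "Suc k"] by (simp add: cis_mult algebra_simps)
  qed simp
  have "similar_to_planar n A B"
  proof (rule similar_to_planarI[where m = "Suc v" and K = K])
    show "K \<noteq> 0" unfolding K_def by (rule h_tan_neq_0)
    show "z (Suc v + k) = K * B k" if "k < n" for k
    proof (cases k)
      case 0
      have half: "tan (pi / 2 - a / 2) = cot (a / 2)" by (simp add: tan_cot' cot_def tan_def sin_diff cos_diff)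
      have "tan (a / 2) * cot (a / 2) = 1"
        using a pi_gt_zero tan_gt_zero[of "a / 2"] by (simp add: cot_altdef)
      then have "(of_real (tan (a / 2)) - \<i>) * (- \<i> * of_real (cot (a / 2))) = - of_real (cot (a / 2)) - \<i>"
        by (simp add: complex_eq_iff)
      moreover have "K * B 0 = of_real h * w (Suc v) * ((of_real (tan (a / 2)) - \<i>) * (- \<i> * of_real (cot (a / 2))))"
        by (simp add: B_def K_def)
      ultimately have "K * B 0 = of_real h * w (Suc v) * (- of_real (cot (a / 2)) - \<i>)" by simp
      then show ?thesis
        using z_Suc'[of v] by (simp add: 0 v(1) diff_divide_distrib half)
    next
      case (Suc l)
      then show ?thesis
        using z_Suc[of "Suc v + l"] w[of l] v(2)[of "Suc l"] that by (simp add: B_def K_def)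
    qed
  qed (use A in auto)
  moreover have "fake_regular_polygon p B"
    unfolding B_def[abs_def] by (rule fake_regular_polygon_standard[OF \<open>2 \<le> p\<close>, folded a_eq])
  ultimately show ?thesis using p \<open>2 \<le> p\<close> by blast
qed

text \<open>The vertices \<open>z (v + 1)\<close> and \<open>z (v + 2)\<close> become the upper ones
  of the model; the adjacent supplementary angles make sides \<open>v + 1\<close> and
  \<open>v + 3\<close> parallel.\<close>

lemma trapezeI:
  assumes A: "\<And>i. i \<in> {1..n} \<Longrightarrow> A i = P i" and n4: "n = 4" and "a < pi / 2"
    and v: "t v = a" "t (v + 1) = a" "t (v + 2) = pi - a" "t (v + 3) = pi - a"
  shows "\<exists>\<theta>\<in>{0<..<pi/2}. n = 4 \<and> similar_to_planar 4 A (trapeze \<theta>)"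
proof -
  \<comment> \<open>Half of the interior angle \<open>pi - a\<close> at the two upper
    vertices.\<close>
  define \<theta> where "\<theta> = pi / 2 - a / 2"
  have \<theta>: "\<theta> \<in> {0<..<pi/2}" using a assms(3) by (auto simp: \<theta>_def)
  have sin: "0 < sin \<theta>"
    using \<theta> by (auto intro: sin_gt_zero)
  have a_\<theta>: "a = pi - 2 * \<theta>" by (simp add: \<theta>_def)
  have tan_a: "tan (a / 2) = cos \<theta> / sin \<theta>"
    unfolding a_\<theta> by (simp add: tan_def diff_divide_distrib sin_diff cos_diff)
  have tan_b: "tan ((pi - a) / 2) = tan \<theta>" by (simp add: a_\<theta>)
  define W where "W = w (Suc v)"
  \<comment> \<open>Takes the first model side, at distance \<open>sin \<theta>\<close> from 0 with
    direction -1, to side \<open>v + 1\<close>, at distance \<open>h\<close> with direction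
    \<open>W\<close>.\<close>
  define K where "K = - of_real h * W / of_real (sin \<theta>)"
  have w3: "w (v + 3) = - W"
    using w_Suc[of "Suc v"] w_Suc[of "Suc (Suc v)"] v
    by (simp_all add: W_def mult.assoc cis_mult numeral_2_eq_2 numeral_3_eq_3)
  have K: "K * of_real (sin \<theta>) = - of_real h * W" using sin by (simp add: K_def)
  have "similar_to_planar n A (trapeze \<theta>)"
  proof (rule similar_to_planarI[where m = "Suc v" and K = K])
    show "K \<noteq> 0" using h sin by (simp add: K_def W_def w_cis)
    have 0: "z (v + 1) = K * trapeze \<theta> 0"
    proof -
      have "trapeze \<theta> 0 = of_real (sin \<theta>) * (of_real (cos \<theta> / sin \<theta>) + \<i>)"
        using sin by (simp add: trapeze_def complex_eq_iff)
      then have "K * trapeze \<theta> 0 = - of_real h * W * (of_real (cos \<theta> / sin \<theta>) + \<i>)"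
        by (simp only: mult.assoc[symmetric] K)
      also have "\<dots> = of_real h * W * (- of_real (tan (a / 2)) - \<i>)"
        by (simp add: tan_a algebra_simps)
      also have "\<dots> = z (v + 1)"
        using z_Suc'[of v] by (simp add: v(1) W_def)
      finally show ?thesis ..
    qed
    have 1: "z (v + 2) = K * trapeze \<theta> 1"
    proof -
      have "trapeze \<theta> 1 = of_real (sin \<theta>) * (- of_real (cos \<theta> / sin \<theta>) + \<i>)"
        using sin by (simp add: trapeze_def complex_eq_iff)
      then have "K * trapeze \<theta> 1 = - of_real h * W * (- of_real (cos \<theta> / sin \<theta>) + \<i>)"
        by (simp only: mult.assoc[symmetric] K)
      also have "\<dots> = of_real h * W * (of_real (tan (a / 2)) - \<i>)"
        by (simp add: tan_a algebra_simps)
      also have "\<dots> = z (v + 2)"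
        using z_Suc[of "v + 1"] v(2) by (simp add: W_def)
      finally show ?thesis ..
    qed
    have 2: "z (v + 3) = K * trapeze \<theta> 2"
    proof -
      have "trapeze \<theta> 2 = of_real (sin \<theta>) * (- of_real (tan \<theta>) - \<i>)"
        using sin by (simp add: trapeze_def complex_eq_iff mult.commute)
      then have "K * trapeze \<theta> 2 = - of_real h * W * (- of_real (tan \<theta>) - \<i>)"
        by (simp only: mult.assoc[symmetric] K)
      then show ?thesis
        using z_Suc'[of "v + 2"] v(3) w3 by (simp add: tan_b numeral_2_eq_2 numeral_3_eq_3)
    qed
    have 3: "z (v + 4) = K * trapeze \<theta> 3"
    proof -
      have "trapeze \<theta> 3 = of_real (sin \<theta>) * (of_real (tan \<theta>) - \<i>)"
        using sin by (simp add: trapeze_def complex_eq_iff mult.commute)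
      then have "K * trapeze \<theta> 3 = - of_real h * W * (of_real (tan \<theta>) - \<i>)"
        by (simp only: mult.assoc[symmetric] K)
      then show ?thesis
        using z_Suc[of "v + 3"] v(4) w3 by (simp add: tan_b add.commute)
    qed
    show "z (Suc v + k) = K * trapeze \<theta> k" if "k < n" for k
    proof -
      have "k = 0 \<or> k = 1 \<or> k = 2 \<or> k = 3" using that n4 by auto
      then show ?thesis using 0 1 2 3 by (elim disjE) (simp_all add: eval_nat_numeral)
    qed
  qed (use A in auto)
  then show ?thesis using \<theta> n4 by auto
qed

text \<open>A side has length \<open>h\<close> times the sum of the tangent lengths at its ends,
  which is the same for all sides when the angles alternate.\<close>

lemma rhombusI:
  assumes A: "\<And>i. i \<in> {1..n} \<Longrightarrow> A i = P i" "A (n + 1) = P (n + 1)" and n4: "n = 4"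
    and alt: "\<And>i. t (Suc i) = pi - t i"
  shows "rhombus n A"
proof -
  interpret J: linear "frame p q" by (rule linear_frame)
  have "P i \<in> affine hull {g, g + p, g + q}" for i
  proof -
    have "P i = (1 - Re (z i) - Im (z i)) *\<^sub>R g + Re (z i) *\<^sub>R (g + p) + Im (z i) *\<^sub>R (g + q)"
      by (simp add: P frame_def algebra_simps)
    moreover have "(1 - Re (z i) - Im (z i)) + Re (z i) + Im (z i) = 1" by simp
    ultimately show ?thesis unfolding affine_hull_3 by blast
  qed
  then have "A ` {1..4} \<subseteq> affine hull {g, g + p, g + q}"
    using A(1) n4 by auto
  then have coplanar: "coplanar (A ` {1..4})" unfolding coplanar_def by blast
  have "dist (P (Suc i)) (P (Suc (Suc i))) = h * (tan (a / 2) + tan ((pi - a) / 2))" for i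
  proof -
    have "z (Suc (Suc i)) - z (Suc i) = of_real (h * (tan (t i / 2) + tan (t (Suc i) / 2))) * w (Suc i)"
      unfolding z_Suc'[of i] z_Suc[of "Suc i"] by (simp add: algebra_simps)
    then have "cmod (z (Suc (Suc i)) - z (Suc i)) = h * (tan (t i / 2) + tan (t (Suc i) / 2))"
      using h tan_half_pos[of i] tan_half_pos[of "Suc i"] by (simp add: norm_mult w_cis del: of_real_mult of_real_add)
    moreover have "tan (t i / 2) + tan (t (Suc i) / 2) = tan (a / 2) + tan ((pi - a) / 2)"
      unfolding alt[of i] using t[of i] by auto
    ultimately show ?thesis
      by (simp add: P dist_norm norm_minus_commute[of "z (Suc i)"] J.diff[symmetric] norm_frame[OF frame])
  qed
  then have "dist (P i) (P (i + 1)) = h * (tan (a / 2) + tan ((pi - a) / 2))" if "0 < i" for i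
    using that by (cases i) auto
  moreover have "A i = P i" if "i \<in> {1..5}" for i
    using that A n4 by (cases "i = 5") auto
  ultimately have sides: "dist (A i) (A (i + 1)) = h * (tan (a / 2) + tan ((pi - a) / 2))" if "i \<in> {1..4}" for i
    using that by auto
  then have "dist (A 1) (A 2) = h * (tan (a / 2) + tan ((pi - a) / 2))"
    using sides[of 1] by (simp add: numeral_2_eq_2)
  then show ?thesis
    unfolding rhombus_def using n4 sides coplanar by auto
qed

text \<open>If \<open>k\<close> of the \<open>n\<close> angles are \<open>pi - a\<close>, total
  turning reads \<open>n * a + k * (pi - 2 * a) = 2 * pi\<close>; the cases are those of
  \<open>k\<close>.\<close>

lemma classification:
  assumes A: "\<And>i. i \<in> {1..n} \<Longrightarrow> A i = P i" "A (n + 1) = P (n + 1)"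
  shows "regular_polygon n A \<or>
         rhombus n A \<or>
         (\<exists>\<theta>\<in>{0<..<pi/2}. n = 4 \<and> similar_to_planar 4 A (trapeze \<theta>)) \<or>
         (\<exists>p\<ge>2. \<exists>B. n = p + 2 \<and> fake_regular_polygon p B \<and> similar_to_planar (p + 2) A B)"
proof (cases "a = pi / 2")
  \<comment> \<open>The two supplementary angles coincide.\<close>
  case True
  then have "t i = pi / 2" for i using t[of i] by auto
  then show ?thesis using regular_polygonI[OF A(1)] by blast
next
  case False
  then have a_less: "a < pi / 2" using a by simp
  define N where "N = {j. j < n \<and> t j \<noteq> a}"
  have N: "finite N" "N \<subseteq> {..<n}" by (auto simp: N_def)
  have N_iff: "t j = (if j \<in> N then pi - a else a)" if "j < n" for j
    using t[of j] that by (auto simp: N_def)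
  have "2 * pi = (\<Sum>j<n. t j)" using total_turning by (simp add: \<phi>_def)
  also have "\<dots> = (\<Sum>j<n. a + (if j \<in> N then pi - 2 * a else 0))"
    by (intro sum.cong) (auto simp: N_iff)
  also have "\<dots> = real n * a + real (card N) * (pi - 2 * a)"
    using N(2) by (simp add: sum.distrib sum.If_cases Int_absorb1)
  finally have count: "real n * a + real (card N) * (pi - 2 * a) = 2 * pi" ..
  consider "card N = 0" | "card N = 1" | "card N = 2" | "3 \<le> card N" by linarith
  then show ?thesis
  proof cases
    case 1
    then have "t i = a" if "i < n" for i using N N_iff[OF that] by simp
    then show ?thesis using regular_polygonI[OF A(1)] by blast
  next
    case 2
    then obtain v where v: "N = {v}" by (auto simp: card_1_singleton_iff)
    have "v < n" using v N(2) by auto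
    have "t v = pi - a" using N_iff[of v] v \<open>v < n\<close> by simp
    moreover have "t (v + k) = a" if "0 < k" "k < n" for k
    proof (cases "v + k < n")
      case True then show ?thesis using N_iff[of "v + k"] v that by simp
    next
      case False
      then have "t (v + k) = t (v + k - n)" using t_periodic[of "v + k - n"] by simp
      then show ?thesis using N_iff[of "v + k - n"] v that \<open>v < n\<close> False by auto
    qed
    moreover have "real (n - 2) * a = pi" using count 2 n by (simp add: of_nat_diff algebra_simps)
    ultimately show ?thesis using fake_regularI[OF A(1)] by blast
  next
    case 3
    then have "(real n - 4) * a = 0" using count by (simp add: algebra_simps)
    then have n4: "n = 4" using a by simp
    then have sum: "t 0 + t 1 + t 2 + t 3 = 2 * pi"
      using total_turning by (simp add: \<phi>_def eval_nat_numeral)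
    have per: "t 4 = t 0" "t 5 = t 1" "t 6 = t 2" "t 7 = t 3"
      using t_periodic[of 0] t_periodic[of 1] t_periodic[of 2] t_periodic[of 3] n4 by simp_all
    have angles: "t 0 = a \<or> t 0 = pi - a" "t 1 = a \<or> t 1 = pi - a" "t 2 = a \<or> t 2 = pi - a"
      "t 3 = a \<or> t 3 = pi - a" by (rule t)+
    show ?thesis
    proof (cases "t 1 = pi - t 0 \<and> t 2 = t 0")
      case True
      then have "t 3 = pi - t 0" using sum by simp
      have "t (Suc i) = pi - t i" for i
      proof -
        define r where "r = i mod 4"
        have i: "i = r + n * (i div 4)" by (simp add: r_def n4)
        have "t i = t r" by (subst i) (rule period(2))
        moreover have "t (Suc i) = t (Suc r)"
          by (subst i) (simp only: add_Suc[symmetric] period(2))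
        moreover have "r = 0 \<or> r = 1 \<or> r = 2 \<or> r = 3" by (auto simp: r_def)
        ultimately show ?thesis
          using True \<open>t 3 = pi - t 0\<close> per by (elim disjE) (simp_all add: eval_nat_numeral)
      qed
      then show ?thesis using rhombusI[OF A n4] by blast
    next
      case False
      \<comment> \<open>Two angles of each kind that do not alternate: those equal to
        \<open>a\<close> are cyclically adjacent.\<close>
      have "\<exists>v. t v = a \<and> t (v + 1) = a \<and> t (v + 2) = pi - a \<and> t (v + 3) = pi - a"
      proof -
        have "(t 0 = a \<and> t 1 = a \<and> t 2 = pi - a \<and> t 3 = pi - a) \<or>
            (t 1 = a \<and> t 2 = a \<and> t 3 = pi - a \<and> t 0 = pi - a) \<or>
            (t 2 = a \<and> t 3 = a \<and> t 0 = pi - a \<and> t 1 = pi - a) \<or>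
            (t 3 = a \<and> t 0 = a \<and> t 1 = pi - a \<and> t 2 = pi - a)"
          using angles sum a_less False by (smt (verit))
        then show ?thesis
        proof (elim disjE conjE, goal_cases)
          case 1 then show ?thesis by (intro exI[of _ 0]) (simp add: eval_nat_numeral)
        next
          case 2 then show ?thesis using per by (intro exI[of _ 1]) (simp add: eval_nat_numeral)
        next
          case 3 then show ?thesis using per by (intro exI[of _ 2]) (simp add: eval_nat_numeral)
        next
          case 4 then show ?thesis using per by (intro exI[of _ 3]) (simp add: eval_nat_numeral)
        qed
      qed
      then show ?thesis using trapezeI[OF A(1) n4 a_less] by blast
    qed
  next
    case 4
    have "card N \<le> n" using card_mono[OF _ N(2)] by simp
    \<comment> \<open>Bounding \<open>a\<close> by \<open>pi / 2\<close> in this form of the count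
      gives \<open>n < 4\<close>, hence \<open>n = card N = 3\<close>.\<close>
    have "(real (card N) - 2) * pi = (2 * real (card N) - real n) * a"
      using count by (simp add: algebra_simps)
    moreover have "0 < (real (card N) - 2) * pi" using 4 by simp
    ultimately have "0 < 2 * real (card N) - real n"
      using a by (simp add: zero_less_mult_iff)
    then have "(2 * real (card N) - real n) * a < (2 * real (card N) - real n) * (pi / 2)"
      using a_less by simp
    with \<open>(real (card N) - 2) * pi = _\<close>
    have "(real (card N) - 2) * pi < (real (card N) - real n / 2) * pi" by (simp add: algebra_simps)
    then have "real n < 4" by simp
    then have "card N = n" "n = 3" using 4 \<open>card N \<le> n\<close> by auto
    then have "N = {..<n}" using N(2) by (intro card_subset_eq) auto
    then have "t i = pi - a" if "i < n" for i using N_iff[OF that] that by simp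
    then show ?thesis using regular_polygonI[OF A(1)] by blast
  qed
qed

end

theorem theorem1p4:
  fixes A :: "nat \<Rightarrow> real ^ 'N" and n :: nat
  assumes "n \<ge> 3" and "polygon n A"
    and "measure hausdorff1 (polygon_curve n A) * first_eigenvalue n A =
         (\<Sum>i=1..n. (norm (vertex_curvature A i))\<^sup>2)"
  shows "regular_polygon n A \<or>
         rhombus n A \<or>
         (\<exists>\<theta>\<in>{0<..<pi/2}. n = 4 \<and> similar_to_planar 4 A (trapeze \<theta>)) \<or>
         (\<exists>p\<ge>2. \<exists>B. n = p + 2 \<and> fake_regular_polygon p B \<and> similar_to_planar (p + 2) A B)"
proof -
  obtain g c where c: "0 < c" and curvature: "\<And>i. i \<in> {1..n} \<Longrightarrow> vertex_curvature A i = c *\<^sub>R (A i - g)"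
    using reilly_equality_curvature[OF assms(2,3)] by blast
  define P where "P i = A (i mod n)" for i
  define e where "e i = (P (Suc i) - P i) /\<^sub>R norm (P (Suc i) - P i)" for i
  note cyclic = polygon_cyclic_sides[OF assms(2), folded P_def]
  have P_periodic: "P (i + n) = P i" for i by (simp add: P_def)
  have P_mod: "P (i mod n + k) = P (i + k)" for i k by (simp add: P_def mod_add_left_eq)
  have "critical_polygon n P g c e"
  proof
    show "e i - e (Suc i) = c *\<^sub>R (P (Suc i) - g)" for i
    proof -
      \<comment> \<open>\<open>Suc r\<close> lies in \<open>{1..n}\<close>, where the curvature
        identity is known; periodicity carries it to all \<open>i\<close>.\<close>
      define r where "r = i mod n"
      have r: "Suc r \<in> {1..n}" using assms(1) by (simp add: r_def Suc_leI)
      have "e r - e (Suc r) = vertex_curvature A (Suc r)"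
        using cyclic(3-5)[OF r] by (simp add: vertex_curvature_def e_def norm_minus_commute[of "P (Suc r)"] algebra_simps)
      also have "\<dots> = c *\<^sub>R (P (Suc r) - g)" using curvature[OF r] cyclic(3)[OF r] by simp
      finally show ?thesis
        using P_mod[of i 0] P_mod[of i 1] P_mod[of i 2] by (simp add: e_def r_def)
    qed
    show "e i = (P (Suc i) - P i) /\<^sub>R norm (P (Suc i) - P i)" for i by (rule e_def)
  qed (fact assms(1) c P_periodic cyclic(1,2))+
  then obtain p q z w t a h where "tangential_polygon n P g p q z w t a h"
    using critical_polygon.tangential_polygon by blast
  then interpret tangential_polygon n P g p q z w t a h .
  show ?thesis
  proof (rule classification)
    show "A (n + 1) = P (n + 1)" using cyclic(5)[of n] assms(1) by simp
  qed (rule cyclic(3))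
qed

end
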